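(* Let $X_1,\dots,X_n$ be i.i.d. real random variables with probability density $f$, and let $f_n^{(r)}(x;h)$ be the sinc estimator of $f^{(r)}$. Let $r,m\ge0$ be integers, and suppose that $f$ is $r+m$ times differentiable and its $(r+m)$-th derivative is square integrable. Then there is a function $\varepsilon(h)$ of $h>0$ (not depending on $n$) with $\varepsilon(h)\le1$ for all $h$ and $\varepsilon(h)\to0$ as $h\to0$ such that, for all $n\ge1$ and $h>0$, $$\mathrm{MISE}(f_n^{(r)}(x;h))<\varepsilon(h)\,h^{2m}R(f^{(r+m)})+\frac{1}{\pi(2r+1)nh^{2r+1}}.$$
   Context: The sinc estimator of $f$ with bandwidth $h>0$ is $f_n(x;h)=\frac{1}{nh}\sum_{j=1}^nK_s\left(\frac{x-X_j}{h}\right)$ with $K_s(x)=\frac{\sin x}{\pi x}$ ($K_s(0)=1/\pi$). The sinc estimator of the derivative $f^{(r)}$ is the $r$-th derivative in $x$: $f_n^{(r)}(x;h)=\frac{1}{nh^{r+1}}\sum_{j=1}^nK_s^{(r)}\left(\frac{x-X_j}{h}\right)$. $\mathrm{MISE}(f_n^{(r)}(x;h))=\mathrm{E}\int_{-\infty}^{\infty}[f_n^{(r)}(x;h)-f^{(r)}(x)]^2\,dx$. For a real function $g$, $R(g)=\int_{-\infty}^{\infty} g^2(x)\,dx$. The $0$-th derivative of a function is the function itself. *)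

theory Defs
  imports "HOL-Probability.Probability"
begin

definition prob_density :: "(real \<Rightarrow> real) \<Rightarrow> bool" where
  "prob_density f \<longleftrightarrow>
     f \<in> borel_measurable borel \<and> (\<forall>x. 0 \<le> f x) \<and> (\<integral>\<^sup>+ x. ennreal (f x) \<partial>lborel) = 1"

definition iid_sample :: "'a measure \<Rightarrow> (real \<Rightarrow> real) \<Rightarrow> nat \<Rightarrow> (nat \<Rightarrow> 'a \<Rightarrow> real) \<Rightarrow> bool" where
  "iid_sample M f n X \<longleftrightarrow>
     prob_space M \<and>
     prob_space.indep_vars M (\<lambda>_. borel) X {1..n} \<and>
     (\<forall>j\<in>{1..n}. distributed M lborel (X j) (\<lambda>x. ennreal (f x)))"

text \<open>Differentiability is meant at every point of the real line.\<close>

definition times_differentiable :: "nat \<Rightarrow> (real \<Rightarrow> real) \<Rightarrow> bool" where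
  "times_differentiable k f \<longleftrightarrow> (\<forall>i<k. \<forall>x. (deriv ^^ i) f differentiable (at x))"

definition square_integrable :: "(real \<Rightarrow> real) \<Rightarrow> bool" where
  "square_integrable g \<longleftrightarrow> g \<in> borel_measurable borel \<and> integrable lborel (\<lambda>x. (g x)\<^sup>2)"

definition R :: "(real \<Rightarrow> real) \<Rightarrow> real" where
  "R g = (LINT x|lborel. (g x)\<^sup>2)"

definition sinc_kernel :: "real \<Rightarrow> real" where
  "sinc_kernel x = (if x = 0 then 1 / pi else sin x / (pi * x))"

text \<open>Here \<open>y 1, \<dots>, y n\<close> are the observed values of the sample.\<close>

definition sinc_estimator :: "nat \<Rightarrow> real \<Rightarrow> (nat \<Rightarrow> real) \<Rightarrow> real \<Rightarrow> real" where
  "sinc_estimator n h y x = 1 / (real n * h) * (\<Sum>j=1..n. sinc_kernel ((x - y j) / h))"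

definition sinc_deriv_estimator :: "nat \<Rightarrow> nat \<Rightarrow> real \<Rightarrow> (nat \<Rightarrow> real) \<Rightarrow> real \<Rightarrow> real" where
  "sinc_deriv_estimator r n h y = (deriv ^^ r) (sinc_estimator n h y)"

text \<open>The mean integrated squared error is taken in the extended nonnegative reals, so that
  a finite upper bound on it also asserts that it is finite.\<close>

definition MISE ::
  "'a measure \<Rightarrow> (nat \<Rightarrow> 'a \<Rightarrow> real) \<Rightarrow> (real \<Rightarrow> real) \<Rightarrow> nat \<Rightarrow> nat \<Rightarrow> real \<Rightarrow> ennreal" where
  "MISE M X f r n h =
     (\<integral>\<^sup>+ \<omega>. (\<integral>\<^sup>+ x. ennreal ((sinc_deriv_estimator r n h (\<lambda>j. X j \<omega>) x - (deriv ^^ r) f x)\<^sup>2)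
        \<partial>lborel) \<partial>M)"

end

theory Submission
  imports Defs
begin

text \<open>Write \<open>\<phi>(t) = \<integral> f(x) e\<^sup>i\<^sup>t\<^sup>x dx\<close> for the characteristic function of \<open>f\<close> and \<open>\<phi>\<^sub>n\<close> for that
  of the empirical distribution of the sample. The sinc kernel is the inverse Fourier transform of
  the indicator of an interval, so the estimator with bandwidth \<open>h\<close> is the inverse Fourier transform
  of \<open>\<phi>\<^sub>n\<close> cut off to \<open>\<bar>t\<bar> \<le> 1/h\<close>. Differentiating \<open>r\<close> times multiplies by \<open>(- i t)\<^sup>r\<close>, and since
  \<open>E \<bar>\<phi>\<^sub>n - \<phi>\<bar>\<^sup>2 = (1 - \<bar>\<phi>\<bar>\<^sup>2) / n\<close>, Plancherel's formula bounds the mean integrated squared error by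
  \<open>1/(2\<pi>)\<close> times
  \<open>\<integral>\<^bsub>\<bar>t\<bar> \<le> 1/h\<^esub> t\<^sup>2\<^sup>r (1 - \<bar>\<phi>\<bar>\<^sup>2) / n dt + \<integral>\<^bsub>\<bar>t\<bar> > 1/h\<^esub> t\<^sup>2\<^sup>r \<bar>\<phi>\<bar>\<^sup>2 dt\<close>.
  The first integral is strictly smaller than the one without \<open>\<bar>\<phi>\<bar>\<^sup>2\<close>, because \<open>\<phi>\<close> is continuous and
  \<open>\<phi>(0) = 1\<close>; this gives the variance term and the strict inequality. In the second,
  \<open>1 \<le> (h t)\<^sup>2\<^sup>m\<close>, so it is at most \<open>h\<^sup>2\<^sup>m\<close> times the tail beyond \<open>1/h\<close> of the integral of
  \<open>t\<^sup>2\<^sup>r\<^sup>+\<^sup>2\<^sup>m \<bar>\<phi>\<bar>\<^sup>2\<close>. That integral is at most \<open>2\<pi> R(f\<^sup>(\<^sup>r\<^sup>+\<^sup>m\<^sup>))\<close>, so the ratio \<open>\<epsilon>(h)\<close> of the tail to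
  \<open>2\<pi> R(f\<^sup>(\<^sup>r\<^sup>+\<^sup>m\<^sup>))\<close> is at most 1 and tends to 0 as \<open>h\<close> does.

  Only two inequalities of Plancherel type are needed, and both hold without an
  \<open>L\<^sup>2\<close> theory of the Fourier transform. The transform \<open>F q\<close> of an integrable \<open>q\<close> satisfies
  \<open>\<integral>\<bar>F q\<bar>\<^sup>2 \<le> 2\<pi> \<integral>\<bar>q\<bar>\<^sup>2\<close> (\<open>nn_integral_square_fourier_le\<close>): insert a Gaussian weight, apply Fubini, and use
  \<open>2 \<bar>q(x) q(y)\<bar> \<le> \<bar>q(x)\<bar>\<^sup>2 + \<bar>q(y)\<bar>\<^sup>2\<close> under the resulting normal density. Conversely, an
  integrable \<open>g\<close> differs from the inverse transform \<open>b\<close> of an integrable \<open>\<beta>\<close> by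
  \<open>\<integral>(g - b)\<^sup>2 \<le> 1/(2\<pi>) \<integral>\<bar>F g - \<beta>\<bar>\<^sup>2\<close> (\<open>nn_integral_square_diff_le\<close>): with a Gaussian weight the right side
  produces, by the first inequality, square integrable functions converging weakly to \<open>g - b\<close>.

  Derivatives enter only through forward differences, which commute with differentiation and
  keep integrable functions integrable. A \<open>k\<close>-fold difference with step \<open>u\<close> multiplies
  the transform by \<open>(e\<^sup>-\<^sup>i\<^sup>t\<^sup>u - 1)\<^sup>k\<close>, of modulus at most \<open>\<bar>t u\<bar>\<^sup>k\<close> and asymptotic to it; dividing
  by \<open>u\<^sup>k\<close> and letting \<open>u\<close> tend to 0, Fatou's lemma turns the two inequalities into
  \<open>nn_integral_fourier_moment_le\<close> and \<open>nn_integral_square_deriv_diff_le\<close>. This way no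
  integrability of the derivatives of lower order has to be derived.\<close>

section \<open>Forward differences and derivatives\<close>

definition fwd_diff :: "real \<Rightarrow> (real \<Rightarrow> 'b::ab_group_add) \<Rightarrow> real \<Rightarrow> 'b" where
  "fwd_diff u g = (\<lambda>x. g (x + u) - g x)"

lemma times_differentiable_Suc:
  "times_differentiable (Suc k) g \<longleftrightarrow>
     (\<forall>x. g differentiable (at x)) \<and> times_differentiable k (deriv g)"
proof -
  have "(\<forall>i<Suc k. P i) \<longleftrightarrow> P 0 \<and> (\<forall>i<k. P (Suc i))" for P
    by (metis less_Suc_eq_0_disj not_less_eq zero_less_Suc)
  then show ?thesis
    unfolding times_differentiable_def by (simp add: funpow_Suc_right del: funpow.simps)
qed

lemma times_differentiable_Suc':
  "times_differentiable (Suc k) g \<longleftrightarrow>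
     times_differentiable k g \<and> (\<forall>x. (deriv ^^ k) g differentiable (at x))"
  unfolding times_differentiable_def by (auto simp: less_Suc_eq)

lemma times_differentiable_mono:
  "times_differentiable k g \<Longrightarrow> j \<le> k \<Longrightarrow> times_differentiable j g"
  unfolding times_differentiable_def by auto

lemma DERIV_deriv_real:
  fixes g :: "real \<Rightarrow> real"
  shows "g differentiable (at x) \<Longrightarrow> (g has_real_derivative deriv g x) (at x)"
  by (simp add: DERIV_deriv_iff_real_differentiable)

lemma times_differentiable_diff:
  assumes "times_differentiable k f" "times_differentiable k g"
  shows "times_differentiable k (\<lambda>x. f x - g x) \<and>
         (deriv ^^ k) (\<lambda>x. f x - g x) = (\<lambda>x. (deriv ^^ k) f x - (deriv ^^ k) g x)"
  using assms
proof (induction k arbitrary: f g)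
  case 0
  then show ?case by (simp add: times_differentiable_def)
next
  case (Suc k)
  have "((\<lambda>x. f x - g x) has_real_derivative deriv f x - deriv g x) (at x)" for x
    using Suc.prems by (intro DERIV_diff DERIV_deriv_real) (auto simp: times_differentiable_Suc)
  then have *: "deriv (\<lambda>x. f x - g x) = (\<lambda>x. deriv f x - deriv g x)"
    "\<And>x. (\<lambda>x. f x - g x) differentiable (at x)"
    by (auto simp: DERIV_imp_deriv real_differentiable_def)
  show ?case
    using Suc.IH[of "deriv f" "deriv g"] Suc.prems
    by (simp add: times_differentiable_Suc * funpow_Suc_right del: funpow.simps)
qed

lemma times_differentiable_shift:
  assumes "times_differentiable k g"
  shows "times_differentiable k (\<lambda>x. g (x + u)) \<and>
         (deriv ^^ k) (\<lambda>x. g (x + u)) = (\<lambda>x. (deriv ^^ k) g (x + u))"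
  using assms
proof (induction k arbitrary: g)
  case 0
  then show ?case by (simp add: times_differentiable_def)
next
  case (Suc k)
  have "((\<lambda>x. g (x + u)) has_real_derivative deriv g (x + u)) (at x)" for x
    using Suc.prems DERIV_shift[of g "deriv g (x + u)" x u] DERIV_deriv_real
    by (auto simp: times_differentiable_Suc)
  then have *: "deriv (\<lambda>x. g (x + u)) = (\<lambda>x. deriv g (x + u))"
    "\<And>x. (\<lambda>x. g (x + u)) differentiable (at x)"
    by (auto simp: DERIV_imp_deriv real_differentiable_def)
  show ?case
    using Suc.IH[of "deriv g"] Suc.prems
    by (simp add: times_differentiable_Suc * funpow_Suc_right del: funpow.simps)
qed

lemma times_differentiable_fwd_diff:
  fixes g :: "real \<Rightarrow> real"
  assumes "times_differentiable k g"
  shows "times_differentiable k (fwd_diff u g)"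
    and "(deriv ^^ k) (fwd_diff u g) = fwd_diff u ((deriv ^^ k) g)"
  using times_differentiable_diff[of k "\<lambda>x. g (x + u)" g]
    times_differentiable_shift[OF assms, of u] assms
  by (simp_all add: fwd_diff_def)

text \<open>The ordinary mean value theorem, once per order: for \<open>fwd_diff u g\<close> the claim of order \<open>k\<close> yields
  a difference of the \<open>k\<close>-th derivative of \<open>g\<close>, at the cost of enlarging the interval by \<open>u\<close>.\<close>

lemma funpow_fwd_diff_mvt:
  fixes g :: "real \<Rightarrow> real"
  assumes "times_differentiable k g" "0 < u"
  shows "\<exists>\<xi>. x \<le> \<xi> \<and> \<xi> \<le> x + k * u \<and> (fwd_diff u ^^ k) g x = u ^ k * (deriv ^^ k) g \<xi>"
  using assms(1)
proof (induction k arbitrary: g)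
  case 0
  then show ?case by (auto intro!: exI[of _ x])
next
  case (Suc k)
  have k: "times_differentiable k g" and d: "\<And>x. (deriv ^^ k) g differentiable (at x)"
    using Suc.prems by (auto simp: times_differentiable_Suc')
  obtain \<xi> where \<xi>: "x \<le> \<xi>" "\<xi> \<le> x + k * u"
      "(fwd_diff u ^^ k) (fwd_diff u g) x = u ^ k * fwd_diff u ((deriv ^^ k) g) \<xi>"
    using Suc.IH[OF times_differentiable_fwd_diff(1)[OF k, of u]]
    by (auto simp: times_differentiable_fwd_diff(2)[OF k])
  obtain z where z: "\<xi> < z" "z < \<xi> + u"
      "(deriv ^^ k) g (\<xi> + u) - (deriv ^^ k) g \<xi> = u * deriv ((deriv ^^ k) g) z"
    using MVT2[of \<xi> "\<xi> + u" "(deriv ^^ k) g" "deriv ((deriv ^^ k) g)"] DERIV_deriv_real[OF d] assms(2)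
    by auto
  show ?case
  proof (intro exI conjI)
    show "(fwd_diff u ^^ Suc k) g x = u ^ Suc k * (deriv ^^ Suc k) g z"
      using \<xi>(3) z(3)
      by (simp add: funpow_Suc_right[of _ "fwd_diff u"] fwd_diff_def[of u "(deriv ^^ k) g"]
          del: funpow.simps(2)) simp
  qed (use \<xi> z in \<open>auto simp: algebra_simps\<close>)
qed

text \<open>The mean value theorem reduces the \<open>r\<close>-fold difference to one difference of the
  \<open>(r - 1)\<close>-st derivative \<open>G\<close>, taken at a point within \<open>(r - 1) u\<close> of \<open>x\<close>. Differentiability of \<open>G\<close>
  at the single point \<open>x\<close> then suffices, because both ends of that difference stay at a
  distance of order \<open>u\<close> from \<open>x\<close>.\<close>

lemma funpow_fwd_diff_quotient_tendsto:
  fixes g :: "real \<Rightarrow> real"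
  assumes "times_differentiable r g"
  shows "((\<lambda>u. (fwd_diff u ^^ r) g x / u ^ r) \<longlongrightarrow> (deriv ^^ r) g x) (at_right 0)"
proof (cases r)
  case 0
  then show ?thesis by simp
next
  case (Suc k)
  define G where "G = (deriv ^^ k) g"
  have k: "times_differentiable k g" and d: "(G has_real_derivative (deriv ^^ r) g x) (at x)"
    using assms DERIV_deriv_real[of G x] by (auto simp: times_differentiable_Suc' Suc G_def)
  let ?D = "(deriv ^^ r) g x"
  show ?thesis
    unfolding tendsto_iff
  proof (intro allI impI)
    fix e :: real assume "0 < e"
    \<comment> \<open>the two ends are at distance at most \<open>(k + 1) u\<close> and \<open>k u\<close> from \<open>x\<close>, in total below \<open>(2 k + 2) u\<close>\<close>
    define e' where "e' = e / (2 * k + 2)"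
    have "e' > 0" using \<open>e > 0\<close> by (simp add: e'_def)
    then obtain \<delta> where "\<delta> > 0" and
      \<delta>: "\<And>y. \<bar>y - x\<bar> < \<delta> \<Longrightarrow> \<bar>G y - G x - ?D * (y - x)\<bar> \<le> e' * \<bar>y - x\<bar>"
      using d[THEN has_field_derivative_imp_has_derivative] unfolding has_derivative_at_alt
      by (auto simp: real_norm_def)
    have "\<forall>\<^sub>F u in at_right 0. 0 < u \<and> u < \<delta> / (k + 1)"
      using \<open>\<delta> > 0\<close> eventually_at_right_real[of 0 "\<delta> / (k + 1)"] by (auto elim: eventually_mono)
    then show "\<forall>\<^sub>F u in at_right 0. dist ((fwd_diff u ^^ r) g x / u ^ r) ?D < e"
    proof eventually_elim
      case (elim u)
      then have u: "0 < u" "(k + 1) * u < \<delta>" by (auto simp: field_simps)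
      obtain \<xi> where \<xi>: "x \<le> \<xi>" "\<xi> \<le> x + k * u"
          "(fwd_diff u ^^ k) (fwd_diff u g) x = u ^ k * (G (\<xi> + u) - G \<xi>)"
        using funpow_fwd_diff_mvt[OF times_differentiable_fwd_diff(1)[OF k, of u] u(1), of x]
        by (auto simp: times_differentiable_fwd_diff(2)[OF k] G_def[symmetric])
          (auto simp: fwd_diff_def)
      have "(fwd_diff u ^^ r) g x / u ^ r - ?D = (G (\<xi> + u) - G \<xi> - ?D * u) / u"
        using \<xi>(3) u(1) by (simp add: Suc funpow_Suc_right field_simps del: funpow.simps)
      moreover have "\<bar>G (\<xi> + u) - G x - ?D * (\<xi> + u - x)\<bar> \<le> e' * \<bar>\<xi> + u - x\<bar>"
        using \<xi> u by (intro \<delta>) (auto simp: algebra_simps)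
      moreover have "\<bar>G \<xi> - G x - ?D * (\<xi> - x)\<bar> \<le> e' * \<bar>\<xi> - x\<bar>"
        using \<xi> u by (intro \<delta>) (auto simp: algebra_simps)
      moreover have "e' * \<bar>\<xi> + u - x\<bar> \<le> e' * ((k + 1) * u)" "e' * \<bar>\<xi> - x\<bar> \<le> e' * (k * u)"
        using \<xi> u \<open>e' > 0\<close>
        by (intro mult_left_mono; simp add: algebra_simps)+
      ultimately have "\<bar>G (\<xi> + u) - G \<xi> - ?D * u\<bar> \<le> e' * (2 * k + 1) * u"
        by (simp add: algebra_simps)
      also have "\<dots> < e' * (2 * k + 2) * u"
        using \<open>e' > 0\<close> u by simp
      also have "\<dots> = e * u" by (simp add: e'_def field_simps)
      finally have "\<bar>G (\<xi> + u) - G \<xi> - ?D * u\<bar> / u < e"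
        using u by (simp add: field_simps)
      then show ?case
        using \<open>_ - ?D = _\<close> u by (simp add: dist_real_def)
    qed
  qed
qed

text \<open>A difference is the integral of \<open>g'\<close> over an interval of length \<open>u\<close>; the Cauchy--Schwarz inequality and
  Fubini give the bound. The derivative may be discontinuous: the fundamental
  theorem is used for the Henstock--Kurzweil integral, which agrees with the Lebesgue integral here
  since \<open>g'\<close> is locally integrable.\<close>

lemma nn_integral_square_fwd_diff_le:
  fixes g :: "real \<Rightarrow> real"
  assumes diff: "\<And>x. g differentiable (at x)"
    and [measurable]: "deriv g \<in> borel_measurable borel"
    and int: "integrable lborel (\<lambda>x. (deriv g x)\<^sup>2)" and u: "0 < u"
  shows "(\<integral>\<^sup>+ x. ennreal ((fwd_diff u g x)\<^sup>2) \<partial>lborel)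
     \<le> ennreal (u\<^sup>2) * (\<integral>\<^sup>+ x. ennreal ((deriv g x)\<^sup>2) \<partial>lborel)"
proof -
  let ?g = "deriv g"
  have pt: "(fwd_diff u g x)\<^sup>2 \<le> u * (LINT s:{0..u}|lborel. (?g (x + s))\<^sup>2)" 
    "set_integrable lborel {0..u} (\<lambda>s. (?g (x + s))\<^sup>2)" for x
  proof -
    define d where "d = fwd_diff u g x / u"
    have i2: "set_integrable lborel {0..u} (\<lambda>s. (?g (x + s))\<^sup>2)"
      using lborel_integrable_real_affine[OF int, of 1 x]
      unfolding set_integrable_def by (intro integrable_mult_indicator) auto
    have i0: "set_integrable lborel {0..u} (\<lambda>s. c)" for c :: real
      using u unfolding set_integrable_def
      by (intro integrable_scaleR_left impI integrable_real_indicator) auto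
    have i1: "set_integrable lborel {0..u} (\<lambda>s. ?g (x + s))"
      unfolding set_integrable_def
    proof (rule Bochner_Integration.integrable_bound)
      show "integrable lborel (\<lambda>s. indicator {0..u} s *\<^sub>R (1 + (?g (x + s))\<^sup>2))"
        using set_integral_add(1)[OF i0 i2, of 1] unfolding set_integrable_def by simp
      have "\<bar>y\<bar> \<le> 1 + y\<^sup>2" for y :: real
        using sum_squares_bound[of 1 "\<bar>y\<bar>"] by (simp add: power2_eq_square)
      then show "AE s in lborel. norm (indicator {0..u} s *\<^sub>R ?g (x + s))
          \<le> norm (indicator {0..u} s *\<^sub>R (1 + (?g (x + s))\<^sup>2))"
        by (auto split: split_indicator)
    qed measurable
    have "((\<lambda>s. ?g (x + s)) has_integral (g (x + u) - g (x + 0))) {0..u}"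
    proof (rule fundamental_theorem_of_calculus)
      show "((\<lambda>s. g (x + s)) has_vector_derivative ?g (x + s)) (at s within {0..u})"
        for s
        using DERIV_shift[of g "?g (x + s)" s x] DERIV_deriv_real[OF diff, of "x + s"]
        by (simp add: has_real_derivative_iff_has_vector_derivative[symmetric] add.commute
              has_field_derivative_at_within)
    qed (use u in auto)
    then have eq: "(LINT s:{0..u}|lborel. ?g (x + s)) = d * u"
      using set_borel_integral_eq_integral(2)[OF i1] u
      by (simp add: integral_unique d_def fwd_diff_def)
    have c0: "(LINT s:{0..u}|lborel. c) = c * u" for c :: real
      using u unfolding set_lebesgue_integral_def by simp
    \<comment> \<open>Cauchy--Schwarz, as nonnegativity of the variance of the derivative around its mean \<open>d\<close>\<close>
    have "0 \<le> (LINT s:{0..u}|lborel. (?g (x + s) - d)\<^sup>2)"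
      unfolding set_lebesgue_integral_def by (intro integral_nonneg_AE) (auto split: split_indicator)
    also have "\<dots> = (LINT s:{0..u}|lborel. ((?g (x + s))\<^sup>2 - 2 * d * ?g (x + s)) + d\<^sup>2)"
      by (simp add: power2_diff algebra_simps)
    also have "\<dots> = (LINT s:{0..u}|lborel. (?g (x + s))\<^sup>2) - 2 * d * (d * u) + d\<^sup>2 * u"
      using i0 i1 i2 by (simp add: eq c0 set_integral_add set_integral_diff)
    finally have "d\<^sup>2 * u \<le> (LINT s:{0..u}|lborel. (?g (x + s))\<^sup>2)"
      by (simp add: power2_eq_square algebra_simps)
    then have "u * (d\<^sup>2 * u) \<le> u * (LINT s:{0..u}|lborel. (?g (x + s))\<^sup>2)"
      using u by (intro mult_left_mono) auto
    then show "(fwd_diff u g x)\<^sup>2 \<le> u * (LINT s:{0..u}|lborel. (?g (x + s))\<^sup>2)" 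
      using u by (simp add: d_def power2_eq_square field_simps)
    show "set_integrable lborel {0..u} (\<lambda>s. (?g (x + s))\<^sup>2)" by fact
  qed
  have "(\<integral>\<^sup>+ x. ennreal ((fwd_diff u g x)\<^sup>2) \<partial>lborel)
     \<le> (\<integral>\<^sup>+ x. ennreal u * (\<integral>\<^sup>+ s. ennreal (indicator {0..u} s * (?g (x + s))\<^sup>2) \<partial>lborel) \<partial>lborel)"
  proof (rule nn_integral_mono)
    fix x
    have "(\<integral>\<^sup>+ s. ennreal (indicator {0..u} s * (?g (x + s))\<^sup>2) \<partial>lborel)
        = ennreal (LINT s:{0..u}|lborel. (?g (x + s))\<^sup>2)"
      using pt(2)[of x] unfolding set_integrable_def set_lebesgue_integral_def
      by (subst nn_integral_eq_integral) (auto)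
    then show "ennreal ((fwd_diff u g x)\<^sup>2)
      \<le> ennreal u * (\<integral>\<^sup>+ s. ennreal (indicator {0..u} s * (?g (x + s))\<^sup>2) \<partial>lborel)"
      using pt(1)[of x] u by (simp add: ennreal_mult'[symmetric] ennreal_leI)
  qed
  also have "\<dots> = ennreal u * (\<integral>\<^sup>+ x. \<integral>\<^sup>+ s. ennreal (indicator {0..u} s * (?g (x + s))\<^sup>2) \<partial>lborel \<partial>lborel)"
    by (subst nn_integral_cmult) auto
  also have "(\<integral>\<^sup>+ x. \<integral>\<^sup>+ s. ennreal (indicator {0..u} s * (?g (x + s))\<^sup>2) \<partial>lborel \<partial>lborel)
     = (\<integral>\<^sup>+ s. \<integral>\<^sup>+ x. ennreal (indicator {0..u} s * (?g (x + s))\<^sup>2) \<partial>lborel \<partial>lborel)"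
    by (rule lborel_pair.Fubini'[symmetric]) measurable
  also have "\<dots> = (\<integral>\<^sup>+ s. (\<integral>\<^sup>+ x. ennreal ((?g x)\<^sup>2) \<partial>lborel) * indicator {0..u} s \<partial>lborel)"
  proof (rule nn_integral_cong)
    fix s
    have "(\<integral>\<^sup>+ x. ennreal ((?g x)\<^sup>2) \<partial>lborel) = (\<integral>\<^sup>+ x. ennreal ((?g (x + s))\<^sup>2) \<partial>lborel)"
      using nn_integral_real_affine[of "\<lambda>x. ennreal ((?g x)\<^sup>2)" 1 s] by (simp add: add.commute)
    then show "(\<integral>\<^sup>+ x. ennreal (indicator {0..u} s * (?g (x + s))\<^sup>2) \<partial>lborel)
      = (\<integral>\<^sup>+ x. ennreal ((?g x)\<^sup>2) \<partial>lborel) * indicator {0..u} s"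
      by (auto split: split_indicator)
  qed
  also have "\<dots> = (\<integral>\<^sup>+ x. ennreal ((?g x)\<^sup>2) \<partial>lborel) * ennreal u"
    using u by (subst nn_integral_cmult_indicator) auto
  finally show ?thesis
    using u by (simp add: power2_eq_square ennreal_mult' mult_ac)
qed

lemma continuous_fwd_diff:
  fixes g :: "real \<Rightarrow> real"
  assumes "continuous_on UNIV g"
  shows "continuous_on UNIV (fwd_diff u g)"
proof -
  have "continuous_on UNIV (\<lambda>x. g (x + u))"
    by (rule continuous_on_compose2[OF assms]) (auto intro!: continuous_intros)
  then show ?thesis
    unfolding fwd_diff_def by (rule continuous_on_diff[OF _ assms])
qed

lemma fwd_diff_measurable [measurable (raw)]:
  fixes g :: "real \<Rightarrow> real"
  assumes [measurable]: "g \<in> borel_measurable borel"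
  shows "fwd_diff u g \<in> borel_measurable borel"
  unfolding fwd_diff_def by measurable

text \<open>Induction on the order, replacing \<open>g\<close> by \<open>fwd_diff u g\<close>: the \<open>k\<close>-th derivative of the latter is
  a difference of the \<open>k\<close>-th derivative of \<open>g\<close>, hence square integrable although the \<open>k\<close>-th
  derivative itself has not been shown to be.\<close>

lemma nn_integral_square_funpow_fwd_diff_le:
  fixes g :: "real \<Rightarrow> real"
  assumes "times_differentiable k g" "square_integrable ((deriv ^^ k) g)" and u: "0 < u"
  shows "(\<integral>\<^sup>+ x. ennreal (((fwd_diff u ^^ k) g x)\<^sup>2) \<partial>lborel)
     \<le> ennreal (u ^ (2 * k)) * (\<integral>\<^sup>+ x. ennreal (((deriv ^^ k) g x)\<^sup>2) \<partial>lborel)"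
  using assms(1,2)
proof (induction k arbitrary: g)
  case 0
  then show ?case by simp
next
  case (Suc k)
  let ?G = "(deriv ^^ k) g"
  have k: "times_differentiable k g" and d: "\<And>x. ?G differentiable (at x)"
    using Suc.prems by (auto simp: times_differentiable_Suc')
  have sq: "deriv ?G \<in> borel_measurable borel" "integrable lborel (\<lambda>x. (deriv ?G x)\<^sup>2)"
    using Suc.prems(2) by (auto simp: square_integrable_def)
  have le: "(\<integral>\<^sup>+ x. ennreal ((fwd_diff u ?G x)\<^sup>2) \<partial>lborel)
     \<le> ennreal (u\<^sup>2) * (\<integral>\<^sup>+ x. ennreal ((deriv ?G x)\<^sup>2) \<partial>lborel)"
    by (rule nn_integral_square_fwd_diff_le[OF d sq u])
  have "continuous_on UNIV ?G"
    using d by (simp add: continuous_on_eq_continuous_at differentiable_imp_continuous_within)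
  then have m: "fwd_diff u ?G \<in> borel_measurable borel"
    by (intro borel_measurable_continuous_onI continuous_fwd_diff)
  have "(\<integral>\<^sup>+ x. ennreal ((deriv ?G x)\<^sup>2) \<partial>lborel) < \<infinity>"
    using sq(2) by (simp add: nn_integral_eq_integral)
  then have "(\<integral>\<^sup>+ x. ennreal ((fwd_diff u ?G x)\<^sup>2) \<partial>lborel) < \<infinity>"
    using le by (auto intro: le_less_trans simp: ennreal_mult_less_top)
  then have "square_integrable ((deriv ^^ k) (fwd_diff u g))"
    using m unfolding times_differentiable_fwd_diff(2)[OF k] square_integrable_def
    by (auto intro!: integrableI_bounded)
  then have "(\<integral>\<^sup>+ x. ennreal (((fwd_diff u ^^ k) (fwd_diff u g) x)\<^sup>2) \<partial>lborel)
     \<le> ennreal (u ^ (2 * k)) * (\<integral>\<^sup>+ x. ennreal ((fwd_diff u ?G x)\<^sup>2) \<partial>lborel)"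
    using Suc.IH[OF times_differentiable_fwd_diff(1)[OF k, of u]]
    by (simp add: times_differentiable_fwd_diff(2)[OF k])
  also have "\<dots> \<le> ennreal (u ^ (2 * k)) * (ennreal (u\<^sup>2) * (\<integral>\<^sup>+ x. ennreal ((deriv ?G x)\<^sup>2) \<partial>lborel))"
    by (intro mult_left_mono le) auto
  also have "\<dots> = ennreal (u ^ (2 * Suc k)) * (\<integral>\<^sup>+ x. ennreal ((deriv ?G x)\<^sup>2) \<partial>lborel)"
  proof -
    have "u ^ (2 * Suc k) = u ^ (2 * k) * u\<^sup>2"
      by (simp add: power_add[symmetric])
    then have "ennreal (u ^ (2 * Suc k)) = ennreal (u ^ (2 * k)) * ennreal (u\<^sup>2)"
      by (simp only: ennreal_mult zero_le_power2 power_mult zero_le_power)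
    then show ?thesis by (simp only: mult.assoc)
  qed
  finally show ?case by (simp only: funpow_Suc_right[of _ "fwd_diff u"] comp_apply funpow.simps(2)[of _ deriv])
qed

section \<open>The Fourier transform of integrable functions\<close>

text \<open>Fatou's lemma for a uniform bound. It removes from such bounds the Gaussian weight, the truncation
  of a function, and the step of the differences.\<close>

lemma nn_integral_le_of_tendsto:
  fixes u :: "nat \<Rightarrow> 'a \<Rightarrow> real"
  assumes [measurable]: "\<And>j. u j \<in> borel_measurable M"
    and lim: "AE x in M. (\<lambda>j. u j x) \<longlonglongrightarrow> v x"
    and le: "\<And>j. (\<integral>\<^sup>+ x. ennreal (u j x) \<partial>M) \<le> C"
  shows "(\<integral>\<^sup>+ x. ennreal (v x) \<partial>M) \<le> C"
proof -
  have "(\<integral>\<^sup>+ x. ennreal (v x) \<partial>M) = (\<integral>\<^sup>+ x. liminf (\<lambda>j. ennreal (u j x)) \<partial>M)"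
    using lim by (intro nn_integral_cong_AE) (auto elim!: eventually_mono
      intro!: lim_imp_Liminf[symmetric] tendsto_ennrealI)
  also have "\<dots> \<le> liminf (\<lambda>j. \<integral>\<^sup>+ x. ennreal (u j x) \<partial>M)"
    by (rule nn_integral_liminf) measurable
  also have "\<dots> \<le> C"
    by (rule Liminf_le) (auto simp: le)
  finally show ?thesis .
qed

lemma cnj_measurable [measurable]: "cnj \<in> borel_measurable borel"
  by (intro borel_measurable_continuous_onI continuous_intros)

definition fourier :: "(real \<Rightarrow> complex) \<Rightarrow> real \<Rightarrow> complex" where
  "fourier q t = (LBINT x. q x * iexp (t * x))"

lemma iexp_measurable [measurable]: "(\<lambda>x. iexp x) \<in> borel_measurable borel"
  by (intro borel_measurable_continuous_onI continuous_intros)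

lemma integrable_times_iexp [simp]:
  fixes q :: "real \<Rightarrow> complex"
  assumes q: "integrable lborel q"
  shows "integrable lborel (\<lambda>x. q x * iexp (t * x))"
proof (rule Bochner_Integration.integrable_bound[OF q])
  have [measurable]: "q \<in> borel_measurable borel" using q by auto
  show "(\<lambda>x. q x * iexp (t * x)) \<in> borel_measurable lborel" by measurable
qed (simp add: norm_mult)

lemma fourier_measurable [measurable]:
  assumes [measurable]: "q \<in> borel_measurable borel"
  shows "fourier q \<in> borel_measurable borel"
  unfolding fourier_def by measurable

lemma cmod_fourier_le:
  assumes "integrable lborel q"
  shows "cmod (fourier q t) \<le> (LBINT x. cmod (q x))"
  using integral_norm_bound[of lborel "\<lambda>x. q x * iexp (t * x)"]
  by (simp add: fourier_def norm_mult)

lemma fourier_diff: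
  assumes "integrable lborel p" "integrable lborel q"
  shows "fourier (\<lambda>t. p t - q t) x = fourier p x - fourier q x"
  using Bochner_Integration.integral_diff[OF integrable_times_iexp[OF assms(1)] integrable_times_iexp[OF assms(2)], of x x]
  by (simp only: fourier_def left_diff_distrib)

lemma integrable_lborel_times:
  fixes f :: "'a::euclidean_space \<Rightarrow> complex" and g :: "'b::euclidean_space \<Rightarrow> complex"
  assumes f: "integrable lborel f" and g: "integrable lborel g"
  shows "integrable (lborel \<Otimes>\<^sub>M lborel) (\<lambda>z. f (fst z) * g (snd z))"
proof (rule lborel_pair.Fubini_integrable)
  have [measurable]: "f \<in> borel_measurable borel" "g \<in> borel_measurable borel"
    using f g by auto
  show "(\<lambda>z. f (fst z) * g (snd z)) \<in> borel_measurable (lborel \<Otimes>\<^sub>M lborel)"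
    by measurable
  show "integrable lborel (\<lambda>x. LBINT y. cmod (f (fst (x, y)) * g (snd (x, y))))"
    using f by (simp add: norm_mult)
  show "AE x in lborel. integrable lborel (\<lambda>y. f (fst (x, y)) * g (snd (x, y)))"
    using g by simp
qed

text \<open>The weight is normalised to 1 at the origin, rather than to integral 1, so that it can be
  removed by letting \<open>s\<close> tend to 0.\<close>

definition gauss_weight :: "real \<Rightarrow> real \<Rightarrow> real" where
  "gauss_weight s t = exp (- (s * t)\<^sup>2 / 2)"

lemma gauss_weight_measurable [measurable]: "gauss_weight s \<in> borel_measurable borel"
  unfolding gauss_weight_def[abs_def] by measurable

lemma gauss_weight_bounds: "0 < gauss_weight s t" "gauss_weight s t \<le> 1"
  by (auto simp: gauss_weight_def)

lemma gauss_weight_nonneg [simp]: "0 \<le> gauss_weight s t"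
  by (rule less_imp_le[OF gauss_weight_bounds(1)])

lemma gauss_weight_eq_normal_density:
  assumes "0 < s"
  shows "gauss_weight s t = sqrt (2 * pi) * std_normal_density (s * t)"
  by (simp add: gauss_weight_def normal_density_def)

lemma integrable_gauss_weight:
  assumes "0 < s"
  shows "integrable lborel (gauss_weight s)"
  using lborel_integrable_real_affine[OF integrable_normal_density[of 1 0], of s 0] assms
  by (simp add: gauss_weight_eq_normal_density cong: Bochner_Integration.integrable_cong)

text \<open>The characteristic function of the standard normal distribution, rescaled. The weight
  concentrates the transform in a normal density of standard deviation \<open>s\<close>, an approximate
  identity as \<open>s\<close> tends to 0.\<close>

lemma fourier_gauss_weight:
  assumes s: "0 < s"
  shows "fourier (\<lambda>t. of_real (gauss_weight s t)) x = of_real (2 * pi * normal_density 0 s x)"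
proof -
  let ?e = "\<lambda>z. complex_of_real (std_normal_density z) * iexp (x / s * z)"
  have "(LBINT z. ?e z) = char std_normal_distribution (x / s)"
    unfolding char_def by (subst integral_density) (auto simp: scaleR_conv_of_real)
  also have "\<dots> = of_real (exp (- (x / s)\<^sup>2 / 2))"
    by (simp add: char_std_normal_distribution)
  finally have 1: "(LBINT z. ?e z) = of_real (exp (- (x / s)\<^sup>2 / 2))" .
  have 2: "(LBINT z. ?e z) = s *\<^sub>R (LBINT t. ?e (0 + s * t))"
    using lborel_integral_real_affine[of s ?e 0] s by simp
  have "fourier (\<lambda>t. of_real (gauss_weight s t)) x = (LBINT t. of_real (sqrt (2 * pi)) * ?e (0 + s * t))"
    unfolding fourier_def using s
    by (intro Bochner_Integration.integral_cong)
      (auto simp: gauss_weight_eq_normal_density mult_ac)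
  also have "\<dots> = of_real (sqrt (2 * pi)) * (LBINT t. ?e (0 + s * t))"
    by (rule integral_mult_right_zero)
  also have "(LBINT t. ?e (0 + s * t)) = of_real (exp (- (x / s)\<^sup>2 / 2) / s)"
    using s unfolding 1[unfolded 2, symmetric] of_real_divide by (simp add: scaleR_conv_of_real 1[unfolded 2, symmetric])
  also have "sqrt (2 * pi) * (exp (- (x / s)\<^sup>2 / 2) / s) = 2 * pi * normal_density 0 s x"
  proof -
    have "sqrt (2 * pi * s\<^sup>2) = sqrt (2 * pi) * s"
      using s by (simp add: real_sqrt_mult)
    moreover have "2 * pi = sqrt (2 * pi) * sqrt (2 * pi)" by simp
    moreover have "sqrt (2 * pi) > 0" by simp
    ultimately show ?thesis
      using s by (simp add: normal_density_def power_divide field_simps del: real_sqrt_mult_self)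
  qed
  then have "of_real (sqrt (2 * pi)) * of_real (exp (- (x / s)\<^sup>2 / 2) / s)
     = complex_of_real (2 * pi * normal_density 0 s x)"
    unfolding of_real_mult[symmetric] by simp
  finally show ?thesis .
qed

lemma normal_density_diff_commute: "normal_density 0 s (x - y) = normal_density 0 s (y - x)"
  by (simp add: normal_density_def power2_commute)

lemma nn_integral_normal_density_shift:
  "0 < s \<Longrightarrow> (\<integral>\<^sup>+ y. ennreal (normal_density 0 s (x - y)) \<partial>lborel) = 1"
proof -
  assume s: "0 < s"
  have eq: "normal_density 0 s (x - y) = normal_density x s y" for y
    by (simp add: normal_density_def power2_commute)
  show ?thesis
    unfolding eq using s by (subst nn_integral_eq_integral) auto
qed

text \<open>Writing \<open>F q\<close> for the transform and \<open>\<bar>F q (t)\<bar>\<^sup>2\<close> as a double integral of \<open>q(x)\<close> times the conjugate of \<open>q(y)\<close> and integrating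
  over \<open>t\<close> first leaves the kernel \<open>2\<pi> N(x - y)\<close> with \<open>N\<close> a normal density. Its marginals integrate to 1,
  so the arithmetic-geometric mean inequality finishes the estimate.\<close>

lemma fourier_square_gauss_le:
  fixes q :: "real \<Rightarrow> complex"
  assumes q: "integrable lborel q" and s: "0 < s"
  shows "(\<integral>\<^sup>+ t. ennreal (gauss_weight s t * (cmod (fourier q t))\<^sup>2) \<partial>lborel)
     \<le> ennreal (2 * pi) * (\<integral>\<^sup>+ x. ennreal ((cmod (q x))\<^sup>2) \<partial>lborel)"
proof -
  have [measurable]: "q \<in> borel_measurable borel" using q by auto
  define H where "H = (\<lambda>z. q (fst z) * cnj (q (snd z)))"
  define N where "N = (\<lambda>z :: real \<times> real. normal_density 0 s (fst z - snd z))"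
  have Hm [measurable]: "H \<in> borel_measurable borel" "N \<in> borel_measurable borel"
  proof -
    have "H \<in> borel_measurable (borel \<Otimes>\<^sub>M borel)" "N \<in> borel_measurable (borel \<Otimes>\<^sub>M borel)"
      unfolding H_def N_def by measurable
    then show "H \<in> borel_measurable borel" "N \<in> borel_measurable borel"
      by (simp_all add: borel_prod)
  qed
  have H: "integrable lborel H"
    using integrable_lborel_times[OF q, of "\<lambda>y. cnj (q y)"] q
    by (simp add: H_def lborel_prod)
  have NP [measurable]: "N \<in> borel_measurable (lborel \<Otimes>\<^sub>M lborel)"
    unfolding N_def by measurable
  have m1: "(\<lambda>z. ennreal ((cmod (q (fst z)))\<^sup>2) * ennreal (N z)) \<in> borel_measurable (lborel \<Otimes>\<^sub>M lborel)"
    and m2: "(\<lambda>z. ennreal ((cmod (q (snd z)))\<^sup>2) * ennreal (N z)) \<in> borel_measurable (lborel \<Otimes>\<^sub>M lborel)"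
    by measurable
  let ?w = "\<lambda>t. complex_of_real (gauss_weight s t)"
  let ?E = "\<lambda>t z. iexp (t * (fst z - snd z))"
  have iw: "integrable lborel ?w"
    using integrable_gauss_weight[OF s] by simp
  have "(\<lambda>p :: real \<times> real \<times> real. ?E (fst p) (snd p)) \<in> borel_measurable borel"
    by (intro borel_measurable_continuous_onI continuous_intros)
  then have Em [measurable]: "(\<lambda>p. ?E (fst p) (snd p)) \<in> borel_measurable (borel \<Otimes>\<^sub>M borel)"
    by (simp add: borel_prod)
  \<comment> \<open>the squared transform as one integral over the plane, ready to be exchanged with that over \<open>t\<close>\<close>
  have sq: "of_real ((cmod (fourier q t))\<^sup>2) = (LBINT z. H z * ?E t z)" for t
  proof -
    have "of_real ((cmod (fourier q t))\<^sup>2) = (LBINT x. q x * iexp (t * x)) * (LBINT y. cnj (q y * iexp (t * y)))"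
      using Bochner_Integration.integral_cnj[of lborel "\<lambda>y. q y * iexp (t * y)"]
      by (simp only: complex_norm_square fourier_def)
    also have "\<dots> = (LBINT x. LBINT y. (q x * iexp (t * x)) * cnj (q y * iexp (t * y)))"
      by simp
    also have "\<dots> = (LBINT z. (q (fst z) * iexp (t * fst z)) * cnj (q (snd z) * iexp (t * snd z)))"
      using lborel_pair.integral_fst'[OF integrable_lborel_times[of "\<lambda>x. q x * iexp (t * x)" "\<lambda>y. cnj (q y * iexp (t * y))"]]
       integrable_times_iexp[OF q, of t]
      by (simp add: lborel_prod del: complex_cnj_mult)
    also have "\<dots> = (LBINT z. H z * ?E t z)"
    proof (rule Bochner_Integration.integral_cong[OF refl])
      fix z :: "real \<times> real"
      have "cnj (iexp (t * snd z)) = exp (- (\<i> * of_real (t * snd z)))"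
        unfolding exp_cnj by simp
      then have E: "?E t z = iexp (t * fst z) * cnj (iexp (t * snd z))"
        unfolding exp_add[symmetric] by (simp only: exp_add[symmetric]) (simp add: right_diff_distrib)
      show "(q (fst z) * iexp (t * fst z)) * cnj (q (snd z) * iexp (t * snd z)) = H z * ?E t z"
        unfolding H_def E complex_cnj_mult by (simp only: mult_ac)
    qed
    finally show ?thesis .
  qed
  have intK: "integrable (lborel \<Otimes>\<^sub>M lborel) (\<lambda>p. ?w (fst p) * H (snd p) * ?E (fst p) (snd p))"
  proof (rule Bochner_Integration.integrable_bound[OF integrable_lborel_times[OF iw H]])
    have "(\<lambda>p. ?w (fst p) * H (snd p) * ?E (fst p) (snd p)) \<in> borel_measurable (borel \<Otimes>\<^sub>M borel)"
      by (intro borel_measurable_times Em) measurable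
    then show "(\<lambda>p. ?w (fst p) * H (snd p) * ?E (fst p) (snd p)) \<in> borel_measurable (lborel \<Otimes>\<^sub>M lborel)"
      by (subst measurable_cong_sets[OF sets_pair_measure_cong[OF sets_lborel sets_lborel] refl])
  qed (simp add: norm_mult)
  have "complex_of_real (LBINT t. gauss_weight s t * (cmod (fourier q t))\<^sup>2)
     = (LBINT t. LBINT z. ?w t * H z * ?E t z)"
    by (simp add: sq[unfolded of_real_power] mult.assoc flip: integral_complex_of_real)
  also have "\<dots> = (LBINT z. LBINT t. ?w t * H z * ?E t z)"
    by (rule lborel_pair.Fubini_integral[symmetric]) (use intK in \<open>simp add: split_beta'\<close>)
  also have "\<dots> = (LBINT z. H z * fourier ?w (fst z - snd z))"
    unfolding fourier_def by (simp add: mult_ac flip: integral_mult_right_zero)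
  also have "\<dots> = (LBINT z. H z * of_real (2 * pi * N z))"
    by (simp add: fourier_gauss_weight[OF s] N_def)
  finally have "\<bar>LBINT t. gauss_weight s t * (cmod (fourier q t))\<^sup>2\<bar> = cmod (LBINT z. H z * of_real (2 * pi * N z))"
    by (metis norm_of_real)
  then have "ennreal (LBINT t. gauss_weight s t * (cmod (fourier q t))\<^sup>2)
      \<le> ennreal (cmod (LBINT z. H z * of_real (2 * pi * N z)))"
    by (intro ennreal_leI) linarith
  also have "\<dots> \<le> (\<integral>\<^sup>+ z. ennreal (cmod (H z * of_real (2 * pi * N z))) \<partial>lborel)"
    using integral_norm_bound_ennreal[of lborel "\<lambda>z. H z * of_real (2 * pi * N z)"]
    by (cases "integrable lborel (\<lambda>z. H z * of_real (2 * pi * N z))")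
      (auto simp: not_integrable_integral_eq)
  also have "\<dots> \<le> (\<integral>\<^sup>+ z. ennreal pi * (ennreal ((cmod (q (fst z)))\<^sup>2) * ennreal (N z)
       + ennreal ((cmod (q (snd z)))\<^sup>2) * ennreal (N z)) \<partial>lborel)"
  proof (rule nn_integral_mono)
    fix z
    have N: "0 \<le> N z" by (simp add: N_def)
    have "cmod (H z * of_real (2 * pi * N z)) = (2 * cmod (q (fst z)) * cmod (q (snd z))) * (pi * N z)"
      using N by (simp add: H_def norm_mult)
    also have "\<dots> \<le> ((cmod (q (fst z)))\<^sup>2 + (cmod (q (snd z)))\<^sup>2) * (pi * N z)"
      using N by (intro mult_right_mono sum_squares_bound) auto
    finally have "cmod (H z * of_real (2 * pi * N z))
      \<le> pi * ((cmod (q (fst z)))\<^sup>2 * N z + (cmod (q (snd z)))\<^sup>2 * N z)"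
      by (simp add: algebra_simps)
    then show "ennreal (cmod (H z * of_real (2 * pi * N z)))
      \<le> ennreal pi * (ennreal ((cmod (q (fst z)))\<^sup>2) * ennreal (N z)
       + ennreal ((cmod (q (snd z)))\<^sup>2) * ennreal (N z))"
      using N by (simp add: ennreal_mult'[symmetric] ennreal_plus[symmetric] ennreal_leI del: ennreal_plus)
  qed
  also have "\<dots> = ennreal pi * ((\<integral>\<^sup>+ z. ennreal ((cmod (q (fst z)))\<^sup>2) * ennreal (N z) \<partial>(lborel \<Otimes>\<^sub>M lborel))
       + (\<integral>\<^sup>+ z. ennreal ((cmod (q (snd z)))\<^sup>2) * ennreal (N z) \<partial>(lborel \<Otimes>\<^sub>M lborel)))"
    unfolding lborel_prod[symmetric] using m1 m2 by (simp add: nn_integral_cmult nn_integral_add)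
  also have "(\<integral>\<^sup>+ z. ennreal ((cmod (q (fst z)))\<^sup>2) * ennreal (N z) \<partial>(lborel \<Otimes>\<^sub>M lborel))
      = (\<integral>\<^sup>+ x. ennreal ((cmod (q x))\<^sup>2) \<partial>lborel)"
    unfolding lborel.nn_integral_fst[OF m1, symmetric]
    using s by (simp add: N_def nn_integral_cmult nn_integral_normal_density_shift)
  also have "(\<integral>\<^sup>+ z. ennreal ((cmod (q (snd z)))\<^sup>2) * ennreal (N z) \<partial>(lborel \<Otimes>\<^sub>M lborel))
      = (\<integral>\<^sup>+ x. ennreal ((cmod (q x))\<^sup>2) \<partial>lborel)"
    unfolding lborel_pair.nn_integral_snd[OF m2, symmetric]
    using s by (simp add: N_def nn_integral_cmult nn_integral_normal_density_shift normal_density_diff_commute)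
  also have "ennreal pi * ((\<integral>\<^sup>+ x. ennreal ((cmod (q x))\<^sup>2) \<partial>lborel) + (\<integral>\<^sup>+ x. ennreal ((cmod (q x))\<^sup>2) \<partial>lborel))
      = ennreal (2 * pi) * (\<integral>\<^sup>+ x. ennreal ((cmod (q x))\<^sup>2) \<partial>lborel)"
  proof -
    have "ennreal (2 * pi) = ennreal pi * 2"
      by (simp add: ennreal_mult' mult.commute)
    then show ?thesis by (simp only: mult_2 mult.assoc)
  qed
  also have "ennreal (LBINT t. gauss_weight s t * (cmod (fourier q t))\<^sup>2)
      = (\<integral>\<^sup>+ t. ennreal (gauss_weight s t * (cmod (fourier q t))\<^sup>2) \<partial>lborel)"
  proof (rule nn_integral_eq_integral[symmetric])
    show "integrable lborel (\<lambda>t. gauss_weight s t * (cmod (fourier q t))\<^sup>2)"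
    proof (rule Bochner_Integration.integrable_bound)
      show "integrable lborel (\<lambda>t. gauss_weight s t * (LBINT x. cmod (q x))\<^sup>2)"
        using integrable_gauss_weight[OF s] by simp
    qed (auto simp: abs_mult gauss_weight_bounds less_imp_le
        intro!: mult_left_mono power_mono cmod_fourier_le[OF q])
  qed (auto simp: gauss_weight_bounds less_imp_le)
  finally show ?thesis .
qed

lemma gauss_weight_tendsto: "(\<lambda>j. gauss_weight (1 / real (Suc j)) t) \<longlonglongrightarrow> 1"
proof -
  have "(\<lambda>j. exp (- (1 / real (Suc j) * t)\<^sup>2 / 2)) \<longlonglongrightarrow> exp (- (0 * t)\<^sup>2 / 2)"
    by (intro tendsto_intros LIMSEQ_Suc lim_1_over_n) auto
  then show ?thesis by (simp add: gauss_weight_def)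
qed

text \<open>The half of Plancherel's theorem that needs no inversion; the right side may be infinite.\<close>

proposition nn_integral_square_fourier_le:
  fixes q :: "real \<Rightarrow> complex"
  assumes q: "integrable lborel q"
  shows "(\<integral>\<^sup>+ t. ennreal ((cmod (fourier q t))\<^sup>2) \<partial>lborel)
     \<le> ennreal (2 * pi) * (\<integral>\<^sup>+ x. ennreal ((cmod (q x))\<^sup>2) \<partial>lborel)"
proof (rule nn_integral_le_of_tendsto)
  have [measurable]: "q \<in> borel_measurable borel" using q by auto
  show "(\<lambda>t. gauss_weight (1 / real (Suc j)) t * (cmod (fourier q t))\<^sup>2) \<in> borel_measurable lborel" for j
    by measurable
  show "AE t in lborel. (\<lambda>j. gauss_weight (1 / real (Suc j)) t * (cmod (fourier q t))\<^sup>2)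
     \<longlonglongrightarrow> (cmod (fourier q t))\<^sup>2"
    using tendsto_mult_right[OF gauss_weight_tendsto] by auto
qed (rule fourier_square_gauss_le[OF q], simp)

section \<open>Square integrals tested against continuous functions\<close>

text \<open>The converse of Young's inequality \<open>2 c u - c\<^sup>2 \<le> u\<^sup>2\<close>, which becomes an equality for \<open>c = u\<close>. Measurable functions are
  almost everywhere limits of continuous ones, so \<open>c\<close> can approach \<open>u\<close> truncated in height and in
  range. Testing with a quadratic expression avoids norms of \<open>c\<close> and the Cauchy--Schwarz inequality.\<close>

lemma nn_integral_square_le_of_dual_bound:
  fixes u :: "real \<Rightarrow> real"
  assumes loc: "\<And>N. 0 \<le> N \<Longrightarrow> integrable lborel (\<lambda>x. indicator {-N..N} x * u x)"
    and dual: "\<And>c N. continuous_on UNIV c \<Longrightarrow> (\<And>x. N < \<bar>x\<bar> \<Longrightarrow> c x = 0) \<Longrightarrow> (\<And>x. \<bar>c x\<bar> \<le> N) \<Longrightarrow>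
      (LBINT x. 2 * c x * u x - (c x)\<^sup>2) \<le> K"
    and [measurable]: "u \<in> borel_measurable borel"
  shows "(\<integral>\<^sup>+ x. ennreal ((u x)\<^sup>2) \<partial>lborel) \<le> ennreal K"
proof -
  define v where "v = (\<lambda>N x. indicator {-N..N} x * max (- N) (min N (u x)) :: real)"
  have v_meas [measurable]: "v N \<in> borel_measurable borel" for N
    unfolding v_def by measurable
  have v_bound: "\<bar>v N x\<bar> \<le> N * indicator {-N..N} x" if "0 \<le> N" for N x
    using that by (auto simp: v_def split: split_indicator)
  have v_sq: "(v N x)\<^sup>2 \<le> 2 * v N x * u x - (v N x)\<^sup>2" if "0 \<le> N" for N x
  proof -
    have "N * N \<le> N * u x" if "N \<le> u x"
      using \<open>0 \<le> N\<close> that by (rule mult_left_mono[rotated])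
    moreover have "N * N \<le> N * - u x" if "u x \<le> - N"
      using \<open>0 \<le> N\<close> that by (intro mult_left_mono) auto
    ultimately have "v N x * v N x \<le> v N x * u x"
      using that by (cases "N \<le> u x"; cases "u x \<le> - N")
        (auto simp: v_def max_def min_def split: split_indicator)
    then show ?thesis by (simp add: power2_eq_square)
  qed
  have ind_int: "integrable lborel (\<lambda>x. indicator {-N..N::real} x :: real)" for N
    by (cases "- N \<le> N") auto
  have main: "(LBINT x. 2 * v N x * u x - (v N x)\<^sup>2) \<le> K" if N: "0 \<le> N" for N
  proof -
    have "v N measurable_on UNIV"
      by (intro lebesgue_measurable_imp_measurable_on) (auto intro: measurable_completion)
    then obtain Z g where Z: "negligible Z" and g: "\<And>n. continuous_on UNIV (g n)"
      and lim: "\<And>x. x \<notin> Z \<Longrightarrow> (\<lambda>n. g n x) \<longlonglongrightarrow> v N x"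
      unfolding measurable_on_def by auto
    \<comment> \<open>the bump is 1 on \<open>[-N, N]\<close>, where \<open>v N\<close> lives, and gives the approximants compact support\<close>
    define bump where "bump = (\<lambda>x::real. max 0 (min 1 (N + 1 - \<bar>x\<bar>)))"
    define c where "c = (\<lambda>n x. bump x * max (- N) (min N (g n x)))"
    have c_cont: "continuous_on UNIV (c n)" for n
      unfolding c_def bump_def by (intro continuous_intros g)
    have [measurable]: "c n \<in> borel_measurable borel" for n
      using c_cont by (rule borel_measurable_continuous_onI)
    have c0: "c n x = 0" if "N + 1 < \<bar>x\<bar>" for n x
      using that by (simp add: c_def bump_def)
    have c_bound: "\<bar>c n x\<bar> \<le> N" for n x
    proof -
      have "\<bar>bump x\<bar> * \<bar>max (- N) (min N (g n x))\<bar> \<le> 1 * N"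
        using N by (intro mult_mono) (auto simp: bump_def)
      then show ?thesis by (simp add: c_def abs_mult)
    qed
    have c_lim: "(\<lambda>n. c n x) \<longlonglongrightarrow> v N x" if "x \<notin> Z" for x
    proof -
      have "(\<lambda>n. c n x) \<longlonglongrightarrow> bump x * max (- N) (min N (v N x))"
        unfolding c_def
        by (intro tendsto_mult tendsto_const tendsto_max tendsto_min lim that)
      also have "bump x * max (- N) (min N (v N x)) = v N x"
      proof (cases "x \<in> {-N..N}")
        case True
        then have "bump x = 1" by (auto simp: bump_def)
        then show ?thesis using v_bound[OF N, of x] True by auto
      next
        case False
        then show ?thesis using N by (simp add: v_def)
      qed
      finally show ?thesis .
    qed
    have AE_Z: "AE x in lborel. x \<notin> Z"
      using AE_not_in[OF Z[unfolded negligible_iff_null_sets]] by (rule AE_completion_iff[THEN iffD1])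
    let ?dom = "\<lambda>x. 2 * N * (indicator {-(N+1)..N+1} x * \<bar>u x\<bar>) + N\<^sup>2 * indicator {-(N+1)..N+1} x"
    have "(\<lambda>n. LBINT x. 2 * c n x * u x - (c n x)\<^sup>2) \<longlonglongrightarrow> (LBINT x. 2 * v N x * u x - (v N x)\<^sup>2)"
    proof (rule integral_dominated_convergence[where w = ?dom])
      have "integrable lborel (\<lambda>x. \<bar>indicator {-(N+1)..N+1} x * u x\<bar>)"
        using loc[of "N + 1"] N by (intro integrable_abs) auto
      then have "integrable lborel (\<lambda>x. indicator {-(N+1)..N+1} x * \<bar>u x\<bar>)"
        by (simp add: abs_mult)
      then show "integrable lborel ?dom"
        using ind_int[of "N + 1"] by (intro Bochner_Integration.integrable_add integrable_mult_right)
      show "AE x in lborel. (\<lambda>n. 2 * c n x * u x - (c n x)\<^sup>2) \<longlonglongrightarrow> 2 * v N x * u x - (v N x)\<^sup>2"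
        using AE_Z by eventually_elim (intro tendsto_intros c_lim)
      show "AE x in lborel. norm (2 * c n x * u x - (c n x)\<^sup>2) \<le> ?dom x" for n
      proof (rule AE_I2)
        fix x
        have "\<bar>c n x\<bar> * \<bar>u x\<bar> \<le> N * \<bar>u x\<bar>" "\<bar>c n x\<bar>\<^sup>2 \<le> N\<^sup>2"
          by (intro mult_right_mono power_mono c_bound abs_ge_zero)+
        moreover have "\<bar>2 * c n x * u x - (c n x)\<^sup>2\<bar> \<le> 2 * (\<bar>c n x\<bar> * \<bar>u x\<bar>) + \<bar>c n x\<bar>\<^sup>2"
          using abs_triangle_ineq4[of "2 * c n x * u x" "(c n x)\<^sup>2"] by (simp add: abs_mult)
        moreover have "c n x = 0" if "x \<notin> {-(N+1)..N+1}"
          using that by (intro c0) auto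
        ultimately show "norm (2 * c n x * u x - (c n x)\<^sup>2) \<le> ?dom x"
          by (auto split: split_indicator)
      qed
    qed measurable
    moreover have "(LBINT x. 2 * c n x * u x - (c n x)\<^sup>2) \<le> K" for n
    proof (rule dual[OF c_cont])
      show "\<bar>c n x\<bar> \<le> N + 1" for x using c_bound[of n x] by simp
    qed (rule c0)
    ultimately show ?thesis
      by (auto intro: LIMSEQ_le_const2)
  qed
  show ?thesis
  proof (rule nn_integral_le_of_tendsto)
    show "(\<lambda>x. (v (real j) x)\<^sup>2) \<in> borel_measurable lborel" for j by measurable
    show "AE x in lborel. (\<lambda>j. (v (real j) x)\<^sup>2) \<longlonglongrightarrow> (u x)\<^sup>2"
    proof (rule AE_I2)
      fix x
      obtain J where J: "max \<bar>x\<bar> \<bar>u x\<bar> \<le> real J" using real_arch_simple by blast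
      have "\<forall>\<^sub>F j in sequentially. (v (real j) x)\<^sup>2 = (u x)\<^sup>2"
        using eventually_ge_at_top[of J]
      proof eventually_elim
        case (elim j)
        then have "\<bar>x\<bar> \<le> real j" "\<bar>u x\<bar> \<le> real j" using J by linarith+
        then show ?case by (auto simp: v_def max_def min_def split: split_indicator)
      qed
      then show "(\<lambda>j. (v (real j) x)\<^sup>2) \<longlonglongrightarrow> (u x)\<^sup>2"
        by (rule tendsto_eventually)
    qed
    fix j
    have i: "integrable lborel (\<lambda>x. 2 * v (real j) x * u x - (v (real j) x)\<^sup>2)"
    proof (rule Bochner_Integration.integrable_bound)
      show "integrable lborel (\<lambda>x. 2 * real j * \<bar>indicator {-real j..real j} x * u x\<bar> + (real j)\<^sup>2 * indicator {-real j..real j} x)"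
        using ind_int[of "real j"] loc[of "real j"]
        by (intro Bochner_Integration.integrable_add integrable_mult_right integrable_abs) auto
      show "AE x in lborel. norm (2 * v (real j) x * u x - (v (real j) x)\<^sup>2)
          \<le> norm (2 * real j * \<bar>indicator {-real j..real j} x * u x\<bar> + (real j)\<^sup>2 * indicator {-real j..real j} x)"
      proof (rule AE_I2)
        fix x
        have "\<bar>v (real j) x\<bar> * \<bar>u x\<bar> \<le> (real j * indicator {-real j..real j} x) * \<bar>u x\<bar>"
          by (intro mult_right_mono v_bound) auto
        moreover have "\<bar>v (real j) x\<bar>\<^sup>2 \<le> (real j * indicator {-real j..real j} x)\<^sup>2"
          by (intro power_mono v_bound) auto
        moreover have "\<bar>2 * v (real j) x * u x - (v (real j) x)\<^sup>2\<bar> \<le> 2 * (\<bar>v (real j) x\<bar> * \<bar>u x\<bar>) + \<bar>v (real j) x\<bar>\<^sup>2"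
          using abs_triangle_ineq4[of "2 * v (real j) x * u x" "(v (real j) x)\<^sup>2"] by (simp add: abs_mult)
        ultimately show "norm (2 * v (real j) x * u x - (v (real j) x)\<^sup>2)
          \<le> norm (2 * real j * \<bar>indicator {-real j..real j} x * u x\<bar> + (real j)\<^sup>2 * indicator {-real j..real j} x)"
          by (auto simp: split: split_indicator)
      qed
    qed measurable
    have i2: "integrable lborel (\<lambda>x. (v (real j) x)\<^sup>2)"
    proof (rule Bochner_Integration.integrable_bound[OF i])
      show "AE x in lborel. norm ((v (real j) x)\<^sup>2) \<le> norm (2 * v (real j) x * u x - (v (real j) x)\<^sup>2)"
        using order_trans[OF v_sq abs_ge_self] by simp
    qed measurable
    have "(LBINT x. (v (real j) x)\<^sup>2) \<le> (LBINT x. 2 * v (real j) x * u x - (v (real j) x)\<^sup>2)"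
      by (rule integral_mono[OF i2 i]) (simp add: v_sq)
    also have "\<dots> \<le> K" by (rule main) simp
    finally show "(\<integral>\<^sup>+ x. ennreal ((v (real j) x)\<^sup>2) \<partial>lborel) \<le> ennreal K"
      using i2 by (subst nn_integral_eq_integral) (auto intro: ennreal_leI)
  qed
qed

section \<open>Comparison with an inverse Fourier transform\<close>

text \<open>Inversion of the weighted transform of \<open>g\<close> gives \<open>2\<pi>\<close> times the convolution of \<open>g\<close> with a normal density. Paired with
  \<open>c\<close>, the smoothing is moved from \<open>g\<close> to \<open>c\<close>, where it converges pointwise for continuous
  \<open>c\<close> (\<open>gauss_smoothing_tendsto\<close>).\<close>

lemma gauss_smoothing_pairing:
  fixes g c :: "real \<Rightarrow> real"
  assumes g: "integrable lborel g" and c: "integrable lborel c" and s: "0 < s"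
  shows "(LBINT x. of_real (c x) * fourier (\<lambda>t. fourier (\<lambda>y. of_real (g y)) t * of_real (gauss_weight s t)) (- x))
     = complex_of_real (2 * pi * (LBINT y. g y * (LBINT z. std_normal_density z * c (y + s * z))))"
proof -
  have [measurable]: "g \<in> borel_measurable borel" "c \<in> borel_measurable borel"
    using g c by auto
  let ?g = "\<lambda>y. complex_of_real (g y)" and ?w = "\<lambda>t. complex_of_real (gauss_weight s t)"
  have ig: "integrable lborel ?g" and iw: "integrable lborel ?w"
    using g integrable_gauss_weight[OF s] by simp_all
  have 1: "fourier (\<lambda>t. fourier ?g t * ?w t) (- x)
      = (LBINT y. ?g y * of_real (2 * pi * normal_density 0 s (y - x)))" for x
  proof -
    have K: "integrable (lborel \<Otimes>\<^sub>M lborel) (\<lambda>p. ?w (fst p) * ?g (snd p) * iexp (fst p * (snd p - x)))"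
    proof (rule Bochner_Integration.integrable_bound[OF integrable_lborel_times[OF iw ig]])
      have "(\<lambda>p :: real \<times> real. iexp (fst p * (snd p - x))) \<in> borel_measurable (lborel \<Otimes>\<^sub>M lborel)"
        by (intro measurable_compose[OF _ iexp_measurable]) measurable
      then show "(\<lambda>p. ?w (fst p) * ?g (snd p) * iexp (fst p * (snd p - x))) \<in> borel_measurable (lborel \<Otimes>\<^sub>M lborel)"
        by (intro borel_measurable_times) measurable
    qed (simp add: norm_mult)
    have "fourier (\<lambda>t. fourier ?g t * ?w t) (- x)
      = (LBINT t. LBINT y. ?w t * ?g y * iexp (t * (y - x)))"
      unfolding fourier_def[of "\<lambda>t. fourier ?g t * ?w t"]
    proof (rule Bochner_Integration.integral_cong[OF refl])
      fix t
      have "iexp (t * (y - x)) = iexp (t * y) * iexp (- x * t)" for y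
        unfolding exp_add[symmetric] by (simp add: algebra_simps)
      then have eq: "(LBINT y. ?w t * ?g y * iexp (t * (y - x)))
          = (LBINT y. (?w t * iexp (- x * t)) * (?g y * iexp (t * y)))"
        by (simp only: mult_ac)
      have "fourier ?g t * ?w t * iexp (- x * t) = (?w t * iexp (- x * t)) * (LBINT y. ?g y * iexp (t * y))"
        by (simp only: fourier_def mult_ac)
      then show "fourier ?g t * ?w t * iexp (- x * t) = (LBINT y. ?w t * ?g y * iexp (t * (y - x)))"
        unfolding eq integral_mult_right_zero .
    qed
    also have "\<dots> = (LBINT y. LBINT t. ?w t * ?g y * iexp (t * (y - x)))"
      by (rule lborel_pair.Fubini_integral[symmetric]) (use K in \<open>simp add: split_beta'\<close>)
    also have "\<dots> = (LBINT y. ?g y * fourier ?w (y - x))"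
      unfolding fourier_def integral_mult_right_zero[symmetric] by (simp only: mult_ac)
    finally show ?thesis by (simp only: fourier_gauss_weight[OF s])
  qed
  have 2: "(LBINT x. c x * normal_density 0 s (y - x)) = (LBINT z. std_normal_density z * c (y + s * z))" for y
  proof -
    have "normal_density 0 s (y - (y + s * z)) = std_normal_density z / s" for z
      using s by (simp add: normal_density_def power_mult_distrib real_sqrt_mult field_simps)
    then show ?thesis
      using s lborel_integral_real_affine[of s "\<lambda>x. c x * normal_density 0 s (y - x)" y]
      by (simp add: mult.commute)
  qed
  have "integrable (lborel \<Otimes>\<^sub>M lborel) (\<lambda>p. of_real (c (fst p)) * ?g (snd p) * of_real (2 * pi * normal_density 0 s (snd p - fst p)))"
  proof (rule Bochner_Integration.integrable_bound)
    define \<kappa> where "\<kappa> = 1 / sqrt (2 * pi * s\<^sup>2)"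
    have \<kappa>: "0 \<le> normal_density 0 s z" "normal_density 0 s z \<le> \<kappa>" for z
      unfolding normal_density_def \<kappa>_def by (auto intro!: divide_right_mono)
    show "integrable (lborel \<Otimes>\<^sub>M lborel) (\<lambda>p. (of_real (c (fst p)) * ?g (snd p)) * complex_of_real (2 * pi * \<kappa>))"
      using c by (intro integrable_mult_left integrable_lborel_times ig) simp
    have "\<bar>2 * pi * normal_density 0 s z\<bar> \<le> \<bar>2 * pi * \<kappa>\<bar>" for z
      using \<kappa>[of z] by (simp add: abs_mult)
    then have "(\<bar>c (fst p)\<bar> * \<bar>g (snd p)\<bar>) * \<bar>2 * pi * normal_density 0 s (snd p - fst p)\<bar>
        \<le> (\<bar>c (fst p)\<bar> * \<bar>g (snd p)\<bar>) * \<bar>2 * pi * \<kappa>\<bar>" for p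
      by (intro mult_left_mono) auto
    then show "AE p in lborel \<Otimes>\<^sub>M lborel. cmod (of_real (c (fst p)) * ?g (snd p) * of_real (2 * pi * normal_density 0 s (snd p - fst p)))
      \<le> cmod ((of_real (c (fst p)) * ?g (snd p)) * complex_of_real (2 * pi * \<kappa>))"
      by (simp only: norm_mult norm_of_real AE_I2)
  qed measurable
  then have "(LBINT x. LBINT y. of_real (c x) * ?g y * of_real (2 * pi * normal_density 0 s (y - x)))
    = (LBINT y. LBINT x. of_real (c x) * ?g y * of_real (2 * pi * normal_density 0 s (y - x)))"
    by (intro lborel_pair.Fubini_integral[symmetric]) (simp add: split_beta')
  then have "(LBINT x. of_real (c x) * fourier (\<lambda>t. fourier ?g t * ?w t) (- x))
    = (LBINT y. LBINT x. of_real (c x) * ?g y * of_real (2 * pi * normal_density 0 s (y - x)))"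
    unfolding 1 integral_mult_right_zero[symmetric] by (simp only: mult_ac)
  also have "\<dots> = (LBINT y. of_real (2 * pi * (g y * (LBINT x. c x * normal_density 0 s (y - x)))))"
  proof (rule Bochner_Integration.integral_cong[OF refl])
    fix y
    have "(LBINT x. of_real (c x) * ?g y * of_real (2 * pi * normal_density 0 s (y - x)))
      = (LBINT x. complex_of_real ((2 * pi * g y) * (c x * normal_density 0 s (y - x))))"
      by (simp only: of_real_mult mult_ac)
    also have "\<dots> = of_real ((2 * pi * g y) * (LBINT x. c x * normal_density 0 s (y - x)))"
      unfolding integral_complex_of_real integral_mult_right_zero ..
    finally show "(LBINT x. of_real (c x) * ?g y * of_real (2 * pi * normal_density 0 s (y - x)))
      = complex_of_real (2 * pi * (g y * (LBINT x. c x * normal_density 0 s (y - x))))"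
      by (simp only: mult.assoc)
  qed
  finally show ?thesis
    by (simp only: integral_complex_of_real integral_mult_right_zero 2)
qed

lemma gauss_smoothing_tendsto:
  fixes g c :: "real \<Rightarrow> real"
  assumes g: "integrable lborel g" and c: "continuous_on UNIV c" and bound: "\<And>x. \<bar>c x\<bar> \<le> N"
  shows "(\<lambda>j. LBINT y. g y * (LBINT z. std_normal_density z * c (y + 1 / real (Suc j) * z)))
     \<longlonglongrightarrow> (LBINT y. g y * c y)"
proof -
  have [measurable]: "g \<in> borel_measurable borel" "c \<in> borel_measurable borel"
    using g c by (auto intro: borel_measurable_continuous_onI)
  have N0: "0 \<le> N" using bound[of 0] by linarith
  have inner: "(\<lambda>j. LBINT z. std_normal_density z * c (y + 1 / real (Suc j) * z)) \<longlonglongrightarrow> c y" for y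
  proof -
    have "(\<lambda>j. LBINT z. std_normal_density z * c (y + 1 / real (Suc j) * z))
       \<longlonglongrightarrow> (LBINT z. std_normal_density z * c y)"
    proof (rule integral_dominated_convergence[where w = "\<lambda>z. std_normal_density z * N"])
      show "AE z in lborel. (\<lambda>j. std_normal_density z * c (y + 1 / real (Suc j) * z)) \<longlonglongrightarrow> std_normal_density z * c y"
      proof (intro AE_I2 tendsto_mult tendsto_const)
        fix z
        have "(\<lambda>j. y + 1 / real (Suc j) * z) \<longlonglongrightarrow> y + 0 * z"
          by (intro tendsto_intros LIMSEQ_Suc lim_1_over_n)
        then show "(\<lambda>j. c (y + 1 / real (Suc j) * z)) \<longlonglongrightarrow> c y"
          using c by (intro isCont_tendsto_compose[of y c]) (auto simp: continuous_on_eq_continuous_at)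
      qed
    qed (auto simp: abs_mult bound intro!: mult_left_mono)
    then show ?thesis by simp
  qed
  show ?thesis
  proof (rule integral_dominated_convergence[where w = "\<lambda>y. \<bar>g y\<bar> * N"])
    show "AE y in lborel. (\<lambda>j. g y * (LBINT z. std_normal_density z * c (y + 1 / real (Suc j) * z))) \<longlonglongrightarrow> g y * c y"
      by (intro AE_I2 tendsto_mult tendsto_const inner)
    show "AE y in lborel. norm (g y * (LBINT z. std_normal_density z * c (y + 1 / real (Suc j) * z))) \<le> \<bar>g y\<bar> * N" for j
    proof (intro AE_I2)
      fix y
      have "\<bar>LBINT z. std_normal_density z * c (y + 1 / real (Suc j) * z)\<bar>
        \<le> (LBINT z. \<bar>std_normal_density z * c (y + 1 / real (Suc j) * z)\<bar>)"
        by (rule integral_abs_bound)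
      also have "\<dots> \<le> (LBINT z. std_normal_density z * N)"
        by (rule integral_mono') (auto simp: abs_mult bound N0 intro!: mult_left_mono)
      finally show "norm (g y * (LBINT z. std_normal_density z * c (y + 1 / real (Suc j) * z))) \<le> \<bar>g y\<bar> * N"
        by (auto simp: abs_mult intro!: mult_left_mono)
    qed
  qed (use g in auto)
qed

text \<open>The half of Plancherel's theorem that contains the inversion formula. With \<open>d = F g - \<beta>\<close>, where \<open>F\<close> denotes the transform, and a
  Gaussian weight, \<open>d\<close> becomes integrable, and its inverse transform \<open>P\<^sub>j\<close> has square integral at
  most \<open>1/(2\<pi>) \<integral>\<bar>d\<bar>\<^sup>2\<close>. As the weight tends to 1, \<open>P\<^sub>j\<close> converges to \<open>g - b\<close> when paired with
  continuous functions of compact support, which is enough for the dual bound.\<close>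

proposition nn_integral_square_diff_le:
  fixes g b :: "real \<Rightarrow> real" and \<beta> :: "real \<Rightarrow> complex"
  assumes g: "integrable lborel g" and \<beta>: "integrable lborel \<beta>"
    and b: "\<And>x. complex_of_real (2 * pi * b x) = fourier \<beta> (- x)"
  shows "(\<integral>\<^sup>+ x. ennreal ((g x - b x)\<^sup>2) \<partial>lborel)
     \<le> ennreal (1 / (2 * pi)) * (\<integral>\<^sup>+ t. ennreal ((cmod (fourier (\<lambda>x. of_real (g x)) t - \<beta> t))\<^sup>2) \<partial>lborel)"
proof (cases "(\<integral>\<^sup>+ t. ennreal ((cmod (fourier (\<lambda>x. of_real (g x)) t - \<beta> t))\<^sup>2) \<partial>lborel) = \<infinity>")
  case True
  then show ?thesis by (simp add: ennreal_mult_top)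
next
  case False
  have [measurable]: "g \<in> borel_measurable borel" "\<beta> \<in> borel_measurable borel"
    using g \<beta> by auto
  let ?G = "fourier (\<lambda>x. complex_of_real (g x))"
  let ?s = "\<lambda>j. 1 / real (Suc j)"
  define d where "d = (\<lambda>t. ?G t - \<beta> t)"
  have [measurable]: "d \<in> borel_measurable borel"
    unfolding d_def by measurable
  have beq: "b x = Re (fourier \<beta> (- x)) / (2 * pi)" for x
    using arg_cong[OF b[of x], of Re] by (simp add: field_simps)
  have [measurable]: "b \<in> borel_measurable borel"
    unfolding beq[abs_def] by measurable
  \<comment> \<open>\<open>d\<close> is square integrable in this case but need not be integrable; the weight makes it so\<close>
  define D where "D = enn2real (\<integral>\<^sup>+ t. ennreal ((cmod (d t))\<^sup>2) \<partial>lborel)"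
  have D: "(\<integral>\<^sup>+ t. ennreal ((cmod (d t))\<^sup>2) \<partial>lborel) = ennreal D" "0 \<le> D"
    using False by (auto simp: D_def d_def top.not_eq_extremum)
  have iG: "integrable lborel (\<lambda>t. ?G t * of_real (gauss_weight (?s j) t))" for j
  proof (rule Bochner_Integration.integrable_bound)
    show "integrable lborel (\<lambda>t. (LBINT x. \<bar>g x\<bar>) * gauss_weight (?s j) t)"
      using integrable_gauss_weight[of "?s j"] by simp
    have "cmod (?G t) \<le> (LBINT x. \<bar>g x\<bar>)" for t
      using cmod_fourier_le[of "\<lambda>x. complex_of_real (g x)" t] g by simp
    then have "cmod (?G t) * \<bar>gauss_weight (?s j) t\<bar> \<le> \<bar>LBINT x. \<bar>g x\<bar>\<bar> * \<bar>gauss_weight (?s j) t\<bar>" for t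
      by (intro mult_right_mono order_trans[OF _ abs_ge_self]) auto
    then show "AE t in lborel. norm (?G t * of_real (gauss_weight (?s j) t))
        \<le> norm ((LBINT x. \<bar>g x\<bar>) * gauss_weight (?s j) t)"
      by (simp only: norm_mult norm_of_real real_norm_def abs_mult AE_I2)
  qed measurable
  have iB: "integrable lborel (\<lambda>t. \<beta> t * of_real (gauss_weight (?s j) t))" for j
    by (rule Bochner_Integration.integrable_bound[OF \<beta>])
      (auto simp: norm_mult gauss_weight_bounds(2) intro!: mult_left_le)
  have id: "integrable lborel (\<lambda>t. d t * of_real (gauss_weight (?s j) t))" for j
    using Bochner_Integration.integrable_diff[OF iG iB, of j j] by (simp add: d_def left_diff_distrib)
  define q where "q = (\<lambda>j t. d t * complex_of_real (gauss_weight (?s j) t))"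
  define P where "P = (\<lambda>j x. fourier (q j) (- x) / (2 * pi))"
  define B where "B = (\<lambda>j x. fourier (\<lambda>t. \<beta> t * complex_of_real (gauss_weight (?s j) t)) (- x))"
  have [measurable]: "q j \<in> borel_measurable borel" for j unfolding q_def by measurable
  have [measurable]: "P j \<in> borel_measurable borel" "B j \<in> borel_measurable borel" for j
    unfolding P_def B_def by measurable
  have iq: "integrable lborel (q j)" for j
    using id[of j] by (simp only: q_def)
  have P_eq: "2 * pi * P j x = fourier (\<lambda>t. ?G t * of_real (gauss_weight (?s j) t)) (- x) - B j x" for j x
    using fourier_diff[OF iG iB, of j j "- x"]
    by (simp add: P_def B_def q_def d_def left_diff_distrib)
  have P_sq: "(\<integral>\<^sup>+ x. ennreal ((cmod (P j x))\<^sup>2) \<partial>lborel) \<le> ennreal (D / (2 * pi))" for j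
  proof -
    have "(\<integral>\<^sup>+ x. ennreal ((cmod (P j x))\<^sup>2) \<partial>lborel)
      = (\<integral>\<^sup>+ x. ennreal (1 / (2 * pi)\<^sup>2) * ennreal ((cmod (fourier (q j) (- x)))\<^sup>2) \<partial>lborel)"
      by (simp add: P_def norm_divide power_divide flip: ennreal_mult')
    also have "\<dots> = ennreal (1 / (2 * pi)\<^sup>2) * (\<integral>\<^sup>+ x. ennreal ((cmod (fourier (q j) (- x)))\<^sup>2) \<partial>lborel)"
      by (rule nn_integral_cmult) measurable
    also have "(\<integral>\<^sup>+ x. ennreal ((cmod (fourier (q j) (- x)))\<^sup>2) \<partial>lborel)
        = (\<integral>\<^sup>+ x. ennreal ((cmod (fourier (q j) x))\<^sup>2) \<partial>lborel)"
      using nn_integral_real_affine[of "\<lambda>x. ennreal ((cmod (fourier (q j) x))\<^sup>2)" "-1" 0] by simp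
    also have "\<dots> \<le> ennreal (2 * pi) * (\<integral>\<^sup>+ t. ennreal ((cmod (q j t))\<^sup>2) \<partial>lborel)"
      using id by (intro nn_integral_square_fourier_le) (simp add: q_def)
    also have "(\<integral>\<^sup>+ t. ennreal ((cmod (q j t))\<^sup>2) \<partial>lborel) \<le> (\<integral>\<^sup>+ t. ennreal ((cmod (d t))\<^sup>2) \<partial>lborel)"
      by (intro nn_integral_mono ennreal_leI power_mono)
        (auto simp: q_def norm_mult gauss_weight_bounds(2) intro!: mult_left_le)
    finally have "(\<integral>\<^sup>+ x. ennreal ((cmod (P j x))\<^sup>2) \<partial>lborel) \<le> ennreal (1 / (2 * pi)\<^sup>2) * (ennreal (2 * pi) * ennreal D)"
      by (simp add: D mult_left_mono)
    also have "\<dots> = ennreal (D / (2 * pi))"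
      using D(2) by (simp add: power2_eq_square flip: ennreal_mult')
    finally show ?thesis .
  qed
  have iP: "integrable lborel (\<lambda>x. (cmod (P j x))\<^sup>2)" "(LBINT x. (cmod (P j x))\<^sup>2) \<le> D / (2 * pi)" for j
  proof -
    show i: "integrable lborel (\<lambda>x. (cmod (P j x))\<^sup>2)"
      by (rule integrableI_bounded) (auto intro: le_less_trans[OF P_sq])
    show "(LBINT x. (cmod (P j x))\<^sup>2) \<le> D / (2 * pi)"
      using P_sq[of j] D(2) i by (subst (asm) nn_integral_eq_integral) auto
  qed
  have "(\<integral>\<^sup>+ x. ennreal ((g x - b x)\<^sup>2) \<partial>lborel) \<le> ennreal (D / (2 * pi))"
  proof (rule nn_integral_square_le_of_dual_bound)
    have b_bound: "\<bar>b x\<bar> \<le> (LBINT t. cmod (\<beta> t)) / (2 * pi)" for x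
      unfolding beq using order_trans[OF abs_Re_le_cmod cmod_fourier_le[OF \<beta>]]
      by (simp add: abs_divide divide_right_mono)
    have ib: "integrable lborel (\<lambda>x. w x * b x)" if "integrable lborel w" for w :: "real \<Rightarrow> real"
    proof (rule Bochner_Integration.integrable_bound)
      show "integrable lborel (\<lambda>x. w x * ((LBINT t. cmod (\<beta> t)) / (2 * pi)))" using that by simp
      have "\<bar>w x\<bar> * \<bar>b x\<bar> \<le> \<bar>w x\<bar> * \<bar>(LBINT t. cmod (\<beta> t)) / (2 * pi)\<bar>" for x
        by (intro mult_left_mono order_trans[OF b_bound abs_ge_self] abs_ge_zero)
      then show "AE x in lborel. norm (w x * b x) \<le> norm (w x * ((LBINT t. cmod (\<beta> t)) / (2 * pi)))"
        by (simp only: real_norm_def abs_mult AE_I2)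
    qed (use that in measurable)
    show "integrable lborel (\<lambda>x. indicator {- N..N} x * (g x - b x))" if "0 \<le> N" for N
    proof -
      have "integrable lborel (\<lambda>x. indicator {- N..N} x * g x)"
        using integrable_mult_indicator[of "{-N..N}" lborel g] g by simp
      moreover have "integrable lborel (\<lambda>x. indicator {- N..N} x * b x)"
        by (rule ib) (auto simp: that)
      ultimately show ?thesis by (simp add: right_diff_distrib)
    qed
    fix c :: "real \<Rightarrow> real" and N :: real
    assume c: "continuous_on UNIV c" and c0: "\<And>x. N < \<bar>x\<bar> \<Longrightarrow> c x = 0" and cN: "\<And>x. \<bar>c x\<bar> \<le> N"
    have [measurable]: "c \<in> borel_measurable borel"
      using c by (rule borel_measurable_continuous_onI)
    have N: "0 \<le> N" using cN[of 0] by linarith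
    have bd: "integrable lborel (\<lambda>x. c x * w x)"
      if [measurable]: "w \<in> borel_measurable borel" and "\<And>x. \<bar>w x\<bar> \<le> W" for w and W :: real
    proof (rule Bochner_Integration.integrable_bound)
      show "integrable lborel (\<lambda>x. N * W * indicator {-N..N} x)" using N by auto
      have "0 \<le> W" using that(2)[of 0] by linarith
      show "AE x in lborel. norm (c x * w x) \<le> norm (N * W * indicator {-N..N} x)"
      proof (rule AE_I2)
        fix x
        have "\<bar>c x\<bar> * \<bar>w x\<bar> \<le> N * W" by (intro mult_mono cN that N) auto
        then show "norm (c x * w x) \<le> norm (N * W * indicator {-N..N} x)"
          using c0[of x] N \<open>0 \<le> W\<close> by (auto simp: abs_mult split: split_indicator)
      qed
    qed measurable
    have ic: "integrable lborel c" using bd[of "\<lambda>_. 1" 1] by simp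
    have icc: "integrable lborel (\<lambda>x. (c x)\<^sup>2)"
      using bd[of c N] cN by (simp add: power2_eq_square)
    have icg: "integrable lborel (\<lambda>x. c x * g x)"
    proof (rule Bochner_Integration.integrable_bound)
      show "integrable lborel (\<lambda>x. N * g x)" using g by simp
      have "\<bar>c x\<bar> * \<bar>g x\<bar> \<le> \<bar>N\<bar> * \<bar>g x\<bar>" for x
        by (intro mult_right_mono order_trans[OF cN abs_ge_self] abs_ge_zero)
      then show "AE x in lborel. norm (c x * g x) \<le> norm (N * g x)"
        by (simp only: real_norm_def abs_mult AE_I2)
    qed measurable
    have B_bound: "cmod (B j x) \<le> (LBINT t. cmod (\<beta> t))" for j x
    proof -
      have "cmod (B j x) \<le> (LBINT t. cmod (\<beta> t * of_real (gauss_weight (?s j) t)))"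
        unfolding B_def by (rule cmod_fourier_le[OF iB])
      also have "\<dots> \<le> (LBINT t. cmod (\<beta> t))"
        by (intro integral_mono integrable_norm iB \<beta>)
          (auto simp: norm_mult gauss_weight_bounds(2) intro!: mult_left_le)
      finally show ?thesis .
    qed
    have B_lim: "(\<lambda>j. B j x) \<longlonglongrightarrow> fourier \<beta> (- x)" for x
      unfolding B_def fourier_def
    proof (rule integral_dominated_convergence[where w = "\<lambda>t. cmod (\<beta> t)"])
      show "AE t in lborel. (\<lambda>j. \<beta> t * of_real (gauss_weight (?s j) t) * iexp (- x * t)) \<longlonglongrightarrow> \<beta> t * iexp (- x * t)"
      proof (rule AE_I2)
        fix t
        have "(\<lambda>j. \<beta> t * of_real (gauss_weight (?s j) t) * iexp (- x * t)) \<longlonglongrightarrow> \<beta> t * of_real 1 * iexp (- x * t)"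
          by (intro tendsto_mult tendsto_const tendsto_of_real gauss_weight_tendsto)
        then show "(\<lambda>j. \<beta> t * of_real (gauss_weight (?s j) t) * iexp (- x * t)) \<longlonglongrightarrow> \<beta> t * iexp (- x * t)"
          by simp
      qed
    qed (use \<beta> in \<open>auto simp: norm_mult gauss_weight_bounds(2) intro!: mult_left_le\<close>)
    have icB: "integrable lborel (\<lambda>x. c x * Re (B j x))" for j
      by (rule bd) (auto intro: order_trans[OF abs_Re_le_cmod B_bound])
    have "(\<lambda>j. LBINT x. c x * Re (B j x)) \<longlonglongrightarrow> (LBINT x. c x * Re (fourier \<beta> (- x)))"
    proof (rule integral_dominated_convergence[where w = "\<lambda>x. \<bar>c x\<bar> * (LBINT t. cmod (\<beta> t))"])
      show "AE x in lborel. (\<lambda>j. c x * Re (B j x)) \<longlonglongrightarrow> c x * Re (fourier \<beta> (- x))"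
        by (intro AE_I2 tendsto_mult tendsto_const tendsto_Re B_lim)
      show "AE x in lborel. norm (c x * Re (B j x)) \<le> \<bar>c x\<bar> * (LBINT t. cmod (\<beta> t))" for j
        by (simp add: abs_mult mult_left_mono order_trans[OF abs_Re_le_cmod B_bound])
    qed (use ic in auto)
    moreover have "(LBINT x. c x * Re (fourier \<beta> (- x))) = (LBINT x. 2 * pi * (c x * b x))"
      by (simp add: beq)
    ultimately have lim1: "(\<lambda>j. LBINT x. c x * Re (B j x)) \<longlonglongrightarrow> 2 * pi * (LBINT x. c x * b x)"
      by simp
    have lim2: "(\<lambda>j. 2 * pi * (LBINT y. g y * (LBINT z. std_normal_density z * c (y + ?s j * z))))
        \<longlonglongrightarrow> 2 * pi * (LBINT y. g y * c y)"
      by (intro tendsto_mult tendsto_const gauss_smoothing_tendsto[OF g c cN])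
    let ?F = "\<lambda>j x. fourier (\<lambda>t. ?G t * of_real (gauss_weight (?s j) t)) (- x)"
    have icF: "integrable lborel (\<lambda>x. complex_of_real (c x) * ?F j x)" for j
    proof (rule Bochner_Integration.integrable_bound)
      let ?C = "LBINT t. cmod (?G t * of_real (gauss_weight (?s j) t))"
      show "integrable lborel (\<lambda>x. c x * ?C)" using ic by simp
      have "\<bar>c x\<bar> * cmod (?F j x) \<le> \<bar>c x\<bar> * \<bar>?C\<bar>" for x
        by (intro mult_left_mono order_trans[OF cmod_fourier_le[OF iG] abs_ge_self] abs_ge_zero)
      then show "AE x in lborel. norm (complex_of_real (c x) * ?F j x) \<le> norm (c x * ?C)"
        by (simp only: norm_mult norm_of_real real_norm_def abs_mult AE_I2)
    qed measurable
    have cP: "(LBINT x. c x * Re (P j x)) * (2 * pi)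
        = 2 * pi * (LBINT y. g y * (LBINT z. std_normal_density z * c (y + ?s j * z))) - (LBINT x. c x * Re (B j x))" for j
    proof -
      have "(LBINT x. c x * Re (P j x)) * (2 * pi) = (LBINT x. c x * Re (2 * pi * P j x))"
        unfolding integral_mult_left_zero[symmetric]
        by (intro Bochner_Integration.integral_cong refl) simp
      also have "\<dots> = (LBINT x. Re (complex_of_real (c x) * ?F j x) - c x * Re (B j x))"
        unfolding P_eq by (simp add: right_diff_distrib)
      also have "\<dots> = Re (LBINT x. complex_of_real (c x) * ?F j x) - (LBINT x. c x * Re (B j x))"
        using icF[of j] icB[of j]
        by (subst Bochner_Integration.integral_diff) (simp_all only: integral_Re integrable_Re)
      finally show ?thesis
        by (subst (asm) gauss_smoothing_pairing[OF g ic]) simp_all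
    qed
    have lim3: "(\<lambda>j. LBINT x. c x * Re (P j x)) \<longlonglongrightarrow> (LBINT x. c x * (g x - b x))"
    proof -
      have "(\<lambda>j. (LBINT x. c x * Re (P j x)) * (2 * pi) / (2 * pi))
          \<longlonglongrightarrow> (2 * pi * (LBINT y. g y * c y) - 2 * pi * (LBINT x. c x * b x)) / (2 * pi)"
        unfolding cP by (intro tendsto_divide tendsto_diff lim1 lim2 tendsto_const) simp
      also have "(2 * pi * (LBINT y. g y * c y) - 2 * pi * (LBINT x. c x * b x)) / (2 * pi)
          = (LBINT x. c x * (g x - b x))"
        using icg ib[OF ic] by (simp add: right_diff_distrib mult.commute field_simps)
      finally show ?thesis by simp
    qed
    have dbl: "(LBINT x. 2 * (c x * w x) - (c x)\<^sup>2) = 2 * (LBINT x. c x * w x) - (LBINT x. (c x)\<^sup>2)"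
      if "integrable lborel (\<lambda>x. c x * w x)" for w
      using Bochner_Integration.integral_diff[OF integrable_mult_right[OF that, of 2] icc]
      unfolding integral_mult_right_zero .
    have "2 * (LBINT x. c x * Re (P j x)) - (LBINT x. (c x)\<^sup>2) \<le> D / (2 * pi)" for j
    proof -
      have iF: "integrable lborel (\<lambda>x. c x * Re (P j x))"
        by (rule bd[where W = "(LBINT t. cmod (q j t)) / (2 * pi)"])
          (auto simp: P_def abs_divide
            intro!: divide_right_mono order_trans[OF abs_Re_le_cmod cmod_fourier_le[OF iq]])
      have "2 * (LBINT x. c x * Re (P j x)) - (LBINT x. (c x)\<^sup>2) = (LBINT x. 2 * (c x * Re (P j x)) - (c x)\<^sup>2)"
        by (rule dbl[OF iF, symmetric])
      also have "\<dots> \<le> (LBINT x. (cmod (P j x))\<^sup>2)"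
      proof (rule integral_mono)
        fix x
        have "0 \<le> (c x - Re (P j x))\<^sup>2" by simp
        moreover have "(Re (P j x))\<^sup>2 \<le> (cmod (P j x))\<^sup>2" by (simp add: cmod_power2)
        ultimately show "2 * (c x * Re (P j x)) - (c x)\<^sup>2 \<le> (cmod (P j x))\<^sup>2"
          by (simp add: power2_diff)
      qed (use iF icc iP(1) in auto)
      finally show ?thesis using iP(2)[of j] by linarith
    qed
    then have "2 * (LBINT x. c x * (g x - b x)) - (LBINT x. (c x)\<^sup>2) \<le> D / (2 * pi)"
      by (intro LIMSEQ_le_const2[OF tendsto_diff[OF tendsto_mult[OF tendsto_const lim3] tendsto_const]]) auto
    moreover have "integrable lborel (\<lambda>x. c x * (g x - b x))"
      using icg ib[OF ic] by (simp add: right_diff_distrib)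
    ultimately show "(LBINT x. 2 * c x * (g x - b x) - (c x)\<^sup>2) \<le> D / (2 * pi)"
      unfolding mult.assoc by (simp only: dbl)
  qed measurable
  also have "ennreal (D / (2 * pi)) = ennreal (1 / (2 * pi)) * ennreal D"
    using D(2) by (simp flip: ennreal_mult')
  finally show ?thesis by (simp add: D(1)[symmetric] d_def)
qed

section \<open>Derivatives in the frequency domain\<close>

lemma integrable_fwd_diff:
  fixes g :: "real \<Rightarrow> real"
  assumes g: "integrable lborel g"
  shows "integrable lborel (fwd_diff u g)"
  using Bochner_Integration.integrable_diff[OF lborel_integrable_real_affine[OF g, of 1 u] g]
  by (simp add: fwd_diff_def add.commute)

lemma fourier_fwd_diff:
  fixes g :: "real \<Rightarrow> real"
  assumes g: "integrable lborel g"
  shows "fourier (\<lambda>x. of_real (fwd_diff u g x)) t = (iexp (- t * u) - 1) * fourier (\<lambda>x. of_real (g x)) t"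
proof -
  let ?g = "\<lambda>x. complex_of_real (g x)"
  have i: "integrable lborel ?g" "integrable lborel (\<lambda>x. ?g (x + u))"
    using g lborel_integrable_real_affine[OF g, of 1 u] by (auto simp: add.commute)
  have "fourier (\<lambda>x. ?g (x + u)) t = (LBINT x. ?g (u + 1 * x) * iexp (- t * u) * iexp (t * (u + 1 * x)))"
    unfolding fourier_def
  proof (rule Bochner_Integration.integral_cong[OF refl])
    fix x
    have "iexp (t * x) = iexp (- t * u) * iexp (t * (u + 1 * x))"
      unfolding exp_add[symmetric] by (simp add: algebra_simps)
    then show "?g (x + u) * iexp (t * x) = ?g (u + 1 * x) * iexp (- t * u) * iexp (t * (u + 1 * x))"
      by (simp only: mult.assoc mult_1 add.commute)
  qed
  also have "\<dots> = (LBINT x. ?g x * iexp (- t * u) * iexp (t * x))"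
    using lborel_integral_real_affine[of 1 "\<lambda>x. ?g x * iexp (- t * u) * iexp (t * x)" u] by simp
  also have "\<dots> = iexp (- t * u) * fourier ?g t"
    unfolding fourier_def integral_mult_right_zero[symmetric] by (simp only: mult_ac)
  finally have "fourier (\<lambda>x. ?g (x + u)) t = iexp (- t * u) * fourier ?g t" .
  then show ?thesis
    using fourier_diff[OF i(2,1), of t] by (simp add: fwd_diff_def left_diff_distrib)
qed

lemma fourier_funpow_fwd_diff:
  fixes g :: "real \<Rightarrow> real"
  assumes "integrable lborel g"
  shows "integrable lborel ((fwd_diff u ^^ k) g)"
    and "fourier (\<lambda>x. of_real ((fwd_diff u ^^ k) g x)) t
      = (iexp (- t * u) - 1) ^ k * fourier (\<lambda>x. of_real (g x)) t"
  by (induction k) (use assms in \<open>auto simp: integrable_fwd_diff fourier_fwd_diff\<close>)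

lemma cmod_iexp_diff_1_le: "cmod (iexp x - 1) \<le> \<bar>x\<bar>"
  using iexp_approx1[of x 0] by simp

lemma iexp_diff_quotient_tendsto:
  "(\<lambda>j. cmod (iexp (- t * (1 / real (Suc j))) - 1) / (1 / real (Suc j))) \<longlonglongrightarrow> \<bar>t\<bar>"
proof -
  have "((\<lambda>z. exp (- \<i> * complex_of_real t * z)) has_field_derivative - \<i> * complex_of_real t) (at 0)"
    by (auto intro!: derivative_eq_intros)
  then have "((\<lambda>h. (exp (- \<i> * complex_of_real t * h) - 1) / h) \<longlongrightarrow> - \<i> * complex_of_real t) (at 0)"
    by (simp add: DERIV_def)
  moreover have "filterlim (\<lambda>j. complex_of_real (1 / real (Suc j))) (at 0) sequentially"
    unfolding filterlim_at
  proof
    have "(\<lambda>j. complex_of_real (1 / real (Suc j))) \<longlonglongrightarrow> of_real 0"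
      by (intro tendsto_of_real LIMSEQ_Suc lim_1_over_n)
    then show "(\<lambda>j. complex_of_real (1 / real (Suc j))) \<longlonglongrightarrow> 0" by simp
  qed (simp del: of_nat_Suc)
  ultimately have "(\<lambda>j. (exp (- \<i> * complex_of_real t * complex_of_real (1 / real (Suc j))) - 1) / complex_of_real (1 / real (Suc j)))
     \<longlonglongrightarrow> - \<i> * complex_of_real t"
    by (rule filterlim_compose)
  from tendsto_norm[OF this] show ?thesis
    by (simp add: norm_divide norm_mult del: of_nat_Suc)
qed

text \<open>The difference quotients of \<open>f\<close> are integrable, so the first Plancherel inequality applies to
  them, uniformly in the step; then the step tends to 0.\<close>

proposition nn_integral_fourier_moment_le:
  fixes f :: "real \<Rightarrow> real"
  assumes f: "integrable lborel f" and diff: "times_differentiable k f"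
    and sq: "square_integrable ((deriv ^^ k) f)"
  shows "(\<integral>\<^sup>+ t. ennreal (t ^ (2 * k) * (cmod (fourier (\<lambda>x. of_real (f x)) t))\<^sup>2) \<partial>lborel)
     \<le> ennreal (2 * pi) * (\<integral>\<^sup>+ x. ennreal (((deriv ^^ k) f x)\<^sup>2) \<partial>lborel)"
proof (rule nn_integral_le_of_tendsto)
  let ?\<phi> = "fourier (\<lambda>x. complex_of_real (f x))"
  have [measurable]: "f \<in> borel_measurable borel" using f by auto
  define u where "u = (\<lambda>j. 1 / real (Suc j))"
  have u: "0 < u j" for j by (simp add: u_def)
  define E where "E = (\<lambda>j t. (cmod (iexp (- t * u j) - 1) / u j) ^ (2 * k) * (cmod (?\<phi> t))\<^sup>2)"
  have "(\<lambda>t. cmod (iexp (- t * v) - 1)) \<in> borel_measurable borel" for v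
    by (intro borel_measurable_continuous_onI continuous_intros)
  note [measurable] = this
  show "E j \<in> borel_measurable lborel" for j
    unfolding E_def by measurable
  show "AE t in lborel. (\<lambda>j. E j t) \<longlonglongrightarrow> t ^ (2 * k) * (cmod (?\<phi> t))\<^sup>2"
  proof (rule AE_I2)
    fix t
    have "(\<lambda>j. E j t) \<longlonglongrightarrow> \<bar>t\<bar> ^ (2 * k) * (cmod (?\<phi> t))\<^sup>2"
      unfolding E_def u_def by (intro tendsto_mult tendsto_power tendsto_const iexp_diff_quotient_tendsto)
    then show "(\<lambda>j. E j t) \<longlonglongrightarrow> t ^ (2 * k) * (cmod (?\<phi> t))\<^sup>2"
      by (simp add: power_mult)
  qed
  fix j
  let ?g = "(fwd_diff (u j) ^^ k) f"
  have E_eq: "E j t = 1 / u j ^ (2 * k) * (cmod (fourier (\<lambda>x. of_real (?g x)) t))\<^sup>2" for t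
    unfolding E_def fourier_funpow_fwd_diff(2)[OF f]
    by (simp add: norm_mult norm_power power_divide power_mult_distrib power_even_eq)
  have "(\<integral>\<^sup>+ t. ennreal (E j t) \<partial>lborel)
     = ennreal (1 / u j ^ (2 * k)) * (\<integral>\<^sup>+ t. ennreal ((cmod (fourier (\<lambda>x. of_real (?g x)) t))\<^sup>2) \<partial>lborel)"
  proof -
    have "?g \<in> borel_measurable borel"
      using fourier_funpow_fwd_diff(1)[OF f] by auto
    note [measurable] = this
    show ?thesis
      unfolding E_eq using u[of j] by (subst nn_integral_cmult[symmetric]) (auto simp flip: ennreal_mult')
  qed
  also have "\<dots> \<le> ennreal (1 / u j ^ (2 * k)) * (ennreal (2 * pi) * (\<integral>\<^sup>+ x. ennreal ((cmod (complex_of_real (?g x)))\<^sup>2) \<partial>lborel))"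
    by (intro mult_left_mono nn_integral_square_fourier_le)
      (simp_all add: fourier_funpow_fwd_diff(1)[OF f])
  also have "\<dots> = ennreal (1 / u j ^ (2 * k)) * (ennreal (2 * pi) * (\<integral>\<^sup>+ x. ennreal ((?g x)\<^sup>2) \<partial>lborel))"
    by simp
  also have "\<dots> \<le> ennreal (1 / u j ^ (2 * k)) * (ennreal (2 * pi) *
       (ennreal (u j ^ (2 * k)) * (\<integral>\<^sup>+ x. ennreal (((deriv ^^ k) f x)\<^sup>2) \<partial>lborel)))"
    by (intro mult_left_mono nn_integral_square_funpow_fwd_diff_le diff sq u) auto
  also have "\<dots> = (ennreal (1 / u j ^ (2 * k)) * ennreal (u j ^ (2 * k))) * (ennreal (2 * pi) *
       (\<integral>\<^sup>+ x. ennreal (((deriv ^^ k) f x)\<^sup>2) \<partial>lborel))"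
    by (simp only: mult_ac)
  also have "ennreal (1 / u j ^ (2 * k)) * ennreal (u j ^ (2 * k)) = 1"
    using u[of j] by (simp flip: ennreal_mult')
  finally show "(\<integral>\<^sup>+ t. ennreal (E j t) \<partial>lborel)
     \<le> ennreal (2 * pi) * (\<integral>\<^sup>+ x. ennreal (((deriv ^^ k) f x)\<^sup>2) \<partial>lborel)"
    by simp
qed

lemma inverse_fourier_funpow_fwd_diff:
  assumes \<beta>: "integrable lborel \<beta>"
    and b: "\<And>x. complex_of_real (2 * pi * b x) = fourier \<beta> (- x)"
  shows "integrable lborel (\<lambda>t. (iexp (- t * u) - 1) ^ k * \<beta> t)"
    and "complex_of_real (2 * pi * (fwd_diff u ^^ k) b x) = fourier (\<lambda>t. (iexp (- t * u) - 1) ^ k * \<beta> t) (- x)"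
proof -
  have *: "integrable lborel (\<lambda>t. (iexp (- t * u) - 1) ^ k * \<beta> t) \<and>
    (\<forall>x. complex_of_real (2 * pi * (fwd_diff u ^^ k) b x) = fourier (\<lambda>t. (iexp (- t * u) - 1) ^ k * \<beta> t) (- x))"
  proof (induction k)
    case 0
    then show ?case using \<beta> b by simp
  next
    case (Suc k)
    define \<gamma> where "\<gamma> = (\<lambda>t. (iexp (- t * u) - 1) ^ k * \<beta> t)"
    have \<gamma>: "integrable lborel \<gamma>" and c: "\<And>x. complex_of_real (2 * pi * (fwd_diff u ^^ k) b x) = fourier \<gamma> (- x)"
      using Suc by (auto simp: \<gamma>_def)
    have i: "integrable lborel (\<lambda>t. \<gamma> t * iexp (- u * t))"
      by (rule integrable_times_iexp[OF \<gamma>])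
    have eq: "(iexp (- t * u) - 1) ^ Suc k * \<beta> t = \<gamma> t * iexp (- u * t) - \<gamma> t" for t
      by (simp add: \<gamma>_def algebra_simps)
    have "complex_of_real (2 * pi * (fwd_diff u ^^ Suc k) b x) = fourier (\<lambda>t. \<gamma> t * iexp (- u * t) - \<gamma> t) (- x)" for x
    proof -
      have e: "iexp (- (x + u) * t) = iexp (- u * t) * iexp (- x * t)" for t
        unfolding exp_add[symmetric] by (simp add: algebra_simps)
      have "fourier \<gamma> (- (x + u)) = fourier (\<lambda>t. \<gamma> t * iexp (- u * t)) (- x)"
        by (simp only: fourier_def e mult.assoc)
      moreover have "complex_of_real (2 * pi * (fwd_diff u ^^ Suc k) b x) = fourier \<gamma> (- (x + u)) - fourier \<gamma> (- x)"
        unfolding c[symmetric] by (simp add: fwd_diff_def right_diff_distrib)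
      ultimately show ?thesis
        by (simp only: fourier_diff[OF i \<gamma>])
    qed
    then show ?case
      unfolding eq using Bochner_Integration.integrable_diff[OF i \<gamma>] by blast
  qed
  show "integrable lborel (\<lambda>t. (iexp (- t * u) - 1) ^ k * \<beta> t)" using * by blast
  show "complex_of_real (2 * pi * (fwd_diff u ^^ k) b x) = fourier (\<lambda>t. (iexp (- t * u) - 1) ^ k * \<beta> t) (- x)"
    using * by blast
qed

lemma funpow_fwd_diff_minus:
  fixes f g :: "real \<Rightarrow> real"
  shows "(fwd_diff u ^^ k) (\<lambda>x. f x - g x) x = (fwd_diff u ^^ k) f x - (fwd_diff u ^^ k) g x"
  by (induction k arbitrary: x) (auto simp: fwd_diff_def)

text \<open>The differences of \<open>f - b\<close> satisfy the comparison inequality, and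
  \<open>\<bar>e\<^sup>-\<^sup>i\<^sup>t\<^sup>u - 1\<bar> \<le> \<bar>t u\<bar>\<close> bounds the right side, divided by \<open>u\<^sup>2\<^sup>r\<close>, by one not depending on the step \<open>u\<close>.\<close>

proposition nn_integral_square_deriv_diff_le:
  fixes f b :: "real \<Rightarrow> real" and \<beta> :: "real \<Rightarrow> complex"
  assumes f: "integrable lborel f" "times_differentiable r f"
    and b: "times_differentiable r b"
    and \<beta>: "integrable lborel \<beta>" "\<And>x. complex_of_real (2 * pi * b x) = fourier \<beta> (- x)"
  shows "(\<integral>\<^sup>+ x. ennreal (((deriv ^^ r) b x - (deriv ^^ r) f x)\<^sup>2) \<partial>lborel)
     \<le> ennreal (1 / (2 * pi)) *
       (\<integral>\<^sup>+ t. ennreal (t ^ (2 * r) * (cmod (fourier (\<lambda>x. of_real (f x)) t - \<beta> t))\<^sup>2) \<partial>lborel)"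
proof (rule nn_integral_le_of_tendsto)
  let ?\<phi> = "fourier (\<lambda>x. complex_of_real (f x))"
  define u where "u = (\<lambda>j. 1 / real (Suc j))"
  have u: "0 < u j" for j by (simp add: u_def)
  let ?D = "\<lambda>j. (fwd_diff (u j) ^^ r) (\<lambda>x. f x - b x)"
  have [measurable]: "f \<in> borel_measurable borel" "\<beta> \<in> borel_measurable borel" using f \<beta> by auto
  have "b x = Re (fourier \<beta> (- x)) / (2 * pi)" for x
    using arg_cong[OF \<beta>(2)[of x], of Re] by (simp add: field_simps)
  then have [measurable]: "b \<in> borel_measurable borel"
    by (subst measurable_cong) auto
  have [measurable]: "(fwd_diff v ^^ k) (\<lambda>x. f x - b x) \<in> borel_measurable borel" for v k
    by (induction k) auto
  show "(\<lambda>x. (?D j x / u j ^ r)\<^sup>2) \<in> borel_measurable lborel" for j by measurable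
  have fb: "times_differentiable r (\<lambda>x. f x - b x)"
      "(deriv ^^ r) (\<lambda>x. f x - b x) = (\<lambda>x. (deriv ^^ r) f x - (deriv ^^ r) b x)"
    using times_differentiable_diff[OF f(2) b] by auto
  have u0: "filterlim u (at_right 0) sequentially"
    unfolding filterlim_at u_def using LIMSEQ_Suc[OF lim_1_over_n] by auto
  show "AE x in lborel. (\<lambda>j. (?D j x / u j ^ r)\<^sup>2) \<longlonglongrightarrow> ((deriv ^^ r) b x - (deriv ^^ r) f x)\<^sup>2"
    using filterlim_compose[OF funpow_fwd_diff_quotient_tendsto[OF fb(1)] u0]
    by (subst power2_commute) (auto simp: fb(2) intro!: tendsto_power)
  fix j
  let ?e = "\<lambda>t. (iexp (- t * u j) - 1) ^ r"
  have le: "(\<integral>\<^sup>+ x. ennreal ((?D j x)\<^sup>2) \<partial>lborel)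
     \<le> ennreal (1 / (2 * pi)) * (\<integral>\<^sup>+ t. ennreal ((cmod (?e t * ?\<phi> t - ?e t * \<beta> t))\<^sup>2) \<partial>lborel)"
    using nn_integral_square_diff_le[OF fourier_funpow_fwd_diff(1)[OF f(1), where u = "u j" and k = r]
       inverse_fourier_funpow_fwd_diff[OF \<beta>, where u = "u j" and k = r]]
    by (simp only: funpow_fwd_diff_minus fourier_funpow_fwd_diff(2)[OF f(1)])
  have "(\<integral>\<^sup>+ x. ennreal ((?D j x / u j ^ r)\<^sup>2) \<partial>lborel)
      = ennreal (1 / u j ^ (2 * r)) * (\<integral>\<^sup>+ x. ennreal ((?D j x)\<^sup>2) \<partial>lborel)"
    using u[of j] by (subst nn_integral_cmult[symmetric])
      (auto simp: power_divide power_even_eq simp flip: ennreal_mult')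
  also have "\<dots> \<le> ennreal (1 / u j ^ (2 * r)) * (ennreal (1 / (2 * pi)) *
      (\<integral>\<^sup>+ t. ennreal (u j ^ (2 * r)) * ennreal (t ^ (2 * r) * (cmod (?\<phi> t - \<beta> t))\<^sup>2) \<partial>lborel))"
  proof (intro mult_left_mono order_trans[OF le] nn_integral_mono)
    fix t
    have "cmod (iexp (- t * u j) - 1) ^ (2 * r) \<le> \<bar>- t * u j\<bar> ^ (2 * r)"
      by (intro power_mono cmod_iexp_diff_1_le) auto
    also have "\<dots> = u j ^ (2 * r) * t ^ (2 * r)"
      by (simp add: power_even_abs power_mult_distrib mult.commute)
    finally have "(cmod (?e t * ?\<phi> t - ?e t * \<beta> t))\<^sup>2 \<le> (u j ^ (2 * r) * t ^ (2 * r)) * (cmod (?\<phi> t - \<beta> t))\<^sup>2"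
      unfolding right_diff_distrib[symmetric] norm_mult power_mult_distrib norm_power
      by (intro mult_right_mono) (simp_all add: power_even_eq)
    then show "ennreal ((cmod (?e t * ?\<phi> t - ?e t * \<beta> t))\<^sup>2)
       \<le> ennreal (u j ^ (2 * r)) * ennreal (t ^ (2 * r) * (cmod (?\<phi> t - \<beta> t))\<^sup>2)"
      by (simp add: mult.assoc ennreal_leI flip: ennreal_mult'')
  qed auto
  also have "\<dots> = (ennreal (1 / u j ^ (2 * r)) * ennreal (u j ^ (2 * r))) * (ennreal (1 / (2 * pi)) *
      (\<integral>\<^sup>+ t. ennreal (t ^ (2 * r) * (cmod (?\<phi> t - \<beta> t))\<^sup>2) \<partial>lborel))"
    by (subst nn_integral_cmult) (measurable, simp only: mult_ac)
  also have "ennreal (1 / u j ^ (2 * r)) * ennreal (u j ^ (2 * r)) = 1"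
    using u[of j] by (simp flip: ennreal_mult')
  finally show "(\<integral>\<^sup>+ x. ennreal ((?D j x / u j ^ r)\<^sup>2) \<partial>lborel) \<le> ennreal (1 / (2 * pi)) *
      (\<integral>\<^sup>+ t. ennreal (t ^ (2 * r) * (cmod (?\<phi> t - \<beta> t))\<^sup>2) \<partial>lborel)"
    by simp
qed

section \<open>The sinc estimator as an inverse Fourier transform\<close>

text \<open>For \<open>i = 0\<close> this is \<open>2 sin (T x) / x\<close>, and in general its \<open>i\<close>-th derivative: each derivative of
  the cosine brings down a factor \<open>t\<close> and shifts the phase by \<open>\<pi>/2\<close>. In this form smoothness at 0
  needs no separate treatment.\<close>

definition cos_moment :: "real \<Rightarrow> nat \<Rightarrow> real \<Rightarrow> real" where
  "cos_moment T i x = integral {- T..T} (\<lambda>t. t ^ i * cos (t * x + real i * pi / 2))"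

lemma DERIV_cos_moment: "(cos_moment T i has_real_derivative cos_moment T (Suc i) x) (at x)"
proof -
  have "((\<lambda>x. integral (cbox (- T) T) (\<lambda>t. t ^ i * cos (t * x + real i * pi / 2)))
      has_real_derivative integral (cbox (- T) T) (\<lambda>t. t ^ Suc i * cos (t * x + real (Suc i) * pi / 2))) (at x within UNIV)"
  proof (rule leibniz_rule_field_derivative)
    fix x t :: real
    have "cos (t * x + real (Suc i) * pi / 2) = - sin (t * x + real i * pi / 2)"
      using cos_add[of "t * x + real i * pi / 2" "pi / 2"] by (simp add: algebra_simps add_divide_distrib)
    then show "((\<lambda>x. t ^ i * cos (t * x + real i * pi / 2)) has_real_derivative
        t ^ Suc i * cos (t * x + real (Suc i) * pi / 2)) (at x within UNIV)"
      by (auto intro!: derivative_eq_intros)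
  next
    show "(\<lambda>t. t ^ i * cos (t * x + real i * pi / 2)) integrable_on cbox (- T) T" for x
      by (intro integrable_continuous continuous_intros)
    show "continuous_on (UNIV \<times> cbox (- T) T) (\<lambda>(x, t). t ^ Suc i * cos (t * x + real (Suc i) * pi / 2))"
      unfolding split_beta by (intro continuous_intros)
  qed auto
  then show ?thesis by (simp add: cos_moment_def[abs_def])
qed

lemma times_differentiable_of_DERIV_chain:
  assumes F: "\<And>i x. (F i has_real_derivative F (Suc i) x) (at x)"
  shows "times_differentiable k (F 0)"
proof -
  have "(deriv ^^ i) (F 0) = F i" for i
    by (induction i) (auto intro!: DERIV_imp_deriv F)
  then show ?thesis
    using F by (auto simp: times_differentiable_def real_differentiable_def)
qed

lemma set_integral_iexp_symmetric:
  assumes T: "0 < T"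
  shows "(LBINT t. indicator {- T..T} t *\<^sub>R iexp (t * z)) = of_real (if z = 0 then 2 * T else 2 * sin (T * z) / z)"
proof (cases "z = 0")
  case True
  then show ?thesis using T by (simp add: scaleR_conv_of_real)
next
  case False
  define A where "A = (\<lambda>t. iexp (t * z) / (\<i> * of_real z))"
  have "(LBINT t. indicator {- T..T} t *\<^sub>R iexp (t * z)) = A T - A (- T)"
  proof (rule integral_FTC_Icc)
    show "(A has_vector_derivative iexp (t * z)) (at t within {- T..T})" for t
    proof -
      have "((\<lambda>w. exp (\<i> * (w * of_real z)) / (\<i> * of_real z)) has_field_derivative exp (\<i> * (of_real t * of_real z))) (at (of_real t))"
        using False by (auto intro!: derivative_eq_intros simp: mult_ac)
      from has_vector_derivative_real_field[OF this] show ?thesis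
        by (auto simp: A_def intro: has_vector_derivative_at_within)
    qed
    show "continuous_on {- T..T} (\<lambda>t. iexp (t * z))"
      by (intro continuous_intros)
  qed (use T in auto)
  also have "\<dots> = of_real (2 * sin (T * z) / z)"
    using False by (simp add: A_def Re_exp Im_exp complex_eq_iff Re_divide Im_divide power2_eq_square field_simps)
  finally show ?thesis using False by simp
qed

lemma cos_moment_0_eq:
  assumes T: "0 < T"
  shows "cos_moment T 0 x = (if x = 0 then 2 * T else 2 * sin (T * x) / x)"
proof -
  have i: "integrable lborel (\<lambda>t. indicator {- T..T} t *\<^sub>R iexp (t * x))"
    by (intro borel_integrable_compact) (auto intro!: continuous_intros)
  have "set_integrable lborel {- T..T} (\<lambda>t. cos (t * x))"
    using integrable_Re[OF i] by (simp add: set_integrable_def Re_exp)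
  then have "cos_moment T 0 x = (LBINT t. indicator {- T..T} t *\<^sub>R cos (t * x))"
    unfolding cos_moment_def by (simp add: set_borel_integral_eq_integral(2)[symmetric] set_lebesgue_integral_def)
  also have "\<dots> = Re (LBINT t. indicator {- T..T} t *\<^sub>R iexp (t * x))"
    by (subst integral_Re[OF i, symmetric]) (simp add: Re_exp)
  finally show ?thesis
    unfolding set_integral_iexp_symmetric[OF T] by simp
qed

lemma sinc_kernel_eq_cos_moment:
  assumes h: "0 < h"
  shows "sinc_kernel (z / h) = h / (2 * pi) * cos_moment (1 / h) 0 z"
  using h by (simp add: cos_moment_0_eq sinc_kernel_def mult.commute)

lemma sinc_estimator_eq_cos_moment:
  assumes h: "0 < h"
  shows "sinc_estimator n h y x = 1 / (2 * pi * real n) * (\<Sum>j=1..n. cos_moment (1 / h) 0 (x - y j))"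
  using h unfolding sinc_estimator_def sinc_kernel_eq_cos_moment[OF h] sum_distrib_left
  by (intro sum.cong) (auto simp: field_simps)

lemma times_differentiable_sinc_estimator:
  assumes h: "0 < h"
  shows "times_differentiable k (sinc_estimator n h y)"
proof -
  define F where "F = (\<lambda>i x. 1 / (2 * pi * real n) * (\<Sum>j=1..n. cos_moment (1 / h) i (x - y j)))"
  have "(F i has_real_derivative F (Suc i) x) (at x)" for i x
  proof -
    have "((\<lambda>x. cos_moment (1 / h) i (x - y j)) has_real_derivative cos_moment (1 / h) (Suc i) (x - y j)) (at x)" for j
      using DERIV_cos_moment[of "1 / h" i "x - y j"]
        DERIV_shift[of "cos_moment (1 / h) i" "cos_moment (1 / h) (Suc i) (x - y j)" x "- y j"] by simp
    then show ?thesis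
      unfolding F_def by (intro DERIV_cmult DERIV_sum)
  qed
  then have "times_differentiable k (F 0)"
    by (rule times_differentiable_of_DERIV_chain)
  then show ?thesis
    by (simp add: F_def sinc_estimator_eq_cos_moment[OF h, abs_def])
qed

definition empirical_char :: "nat \<Rightarrow> (nat \<Rightarrow> real) \<Rightarrow> real \<Rightarrow> complex" where
  "empirical_char n y t = (\<Sum>j=1..n. iexp (t * y j)) / of_nat n"

text \<open>The sinc estimator is band limited: truncating the empirical characteristic function to
  \<open>\<bar>t\<bar> \<le> 1/h\<close> and inverting gives the estimator.\<close>

lemma fourier_truncated_empirical_char:
  fixes n :: nat and h :: real and y :: "nat \<Rightarrow> real"
  assumes h: "0 < h"
  defines "\<beta> \<equiv> (\<lambda>t. indicator {- (1 / h)..1 / h} t *\<^sub>R empirical_char n y t)"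
  shows "integrable lborel \<beta>"
    and "complex_of_real (2 * pi * sinc_estimator n h y x) = fourier \<beta> (- x)"
proof -
  let ?I = "{- (1 / h)..1 / h}"
  have i: "integrable lborel (\<lambda>t. indicator ?I t *\<^sub>R iexp (t * z))" for z
    by (intro borel_integrable_compact) (auto intro!: continuous_intros)
  have \<beta>: "\<beta> t * iexp (- x * t) = (\<Sum>j=1..n. indicator ?I t *\<^sub>R iexp (t * (y j - x))) / of_nat n" for t x
  proof -
    have "iexp (t * (y j - x)) = iexp (t * y j) * iexp (- x * t)" for j
      unfolding exp_add[symmetric] by (simp add: algebra_simps)
    then show ?thesis
      unfolding \<beta>_def empirical_char_def scaleR_sum_right[symmetric] sum_distrib_right[symmetric]
      by (simp only: times_divide_eq_left scaleR_conv_of_real mult.assoc sum_distrib_right[symmetric] times_divide_eq_right)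
  qed
  show "integrable lborel \<beta>"
  proof -
    have "\<beta> = (\<lambda>t. (\<Sum>j=1..n. indicator ?I t *\<^sub>R iexp (t * y j)) / of_nat n)"
      by (simp only: \<beta>_def empirical_char_def scaleR_conv_of_real sum_distrib_left times_divide_eq_right)
    then show ?thesis
      by (simp only: integrable_divide Bochner_Integration.integrable_sum i)
  qed
  have "fourier \<beta> (- x) = (\<Sum>j=1..n. LBINT t. indicator ?I t *\<^sub>R iexp (t * (y j - x))) / of_nat n"
    unfolding fourier_def \<beta> integral_divide_zero
    by (subst Bochner_Integration.integral_sum) (rule i, rule refl)
  also have "\<dots> = (\<Sum>j=1..n. of_real (cos_moment (1 / h) 0 (x - y j))) / of_nat n"
  proof -
    have "(LBINT t. indicator ?I t *\<^sub>R iexp (t * - z)) = of_real (cos_moment (1 / h) 0 z)" for z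
      using h by (subst set_integral_iexp_symmetric) (auto simp: cos_moment_0_eq)
    from this[of "x - y _"]
    have "(LBINT t. indicator ?I t *\<^sub>R iexp (t * (y j - x))) = of_real (cos_moment (1 / h) 0 (x - y j))" for j
      by (simp only: minus_diff_eq)
    then show ?thesis by simp
  qed
  finally show "complex_of_real (2 * pi * sinc_estimator n h y x) = fourier \<beta> (- x)"
    by (simp add: sinc_estimator_eq_cos_moment[OF h])
qed

section \<open>The empirical characteristic function\<close>

lemma prob_density_integrable:
  assumes "prob_density f"
  shows "integrable lborel f"
  by (rule integrableI_nonneg) (use assms in \<open>auto simp: prob_density_def\<close>)

lemma real_distribution_density:
  assumes "prob_density f"
  shows "real_distribution (density lborel f)"
proof -
  have "prob_space (density lborel f)"
    using assms by (intro prob_spaceI) (simp add: prob_density_def emeasure_density)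
  then show ?thesis
    by (simp add: real_distribution_def real_distribution_axioms_def)
qed

lemma char_density_eq_fourier:
  assumes "prob_density f"
  shows "char (density lborel f) t = fourier (\<lambda>x. of_real (f x)) t"
  using assms unfolding char_def fourier_def prob_density_def
  by (subst integral_density) (auto simp: scaleR_conv_of_real)

lemma iid_sample_integral_iexp:
  assumes iid: "iid_sample M f n X" and f: "prob_density f" and j: "j \<in> {1..n}"
  shows "(LINT \<omega>|M. iexp (t * X j \<omega>)) = fourier (\<lambda>x. of_real (f x)) t"
proof -
  have d: "distributed M lborel (X j) (\<lambda>x. ennreal (f x))"
    using iid j by (auto simp: iid_sample_def)
  have "(LINT \<omega>|M. iexp (t * X j \<omega>)) = (LINT x|distr M lborel (X j). iexp (t * x))"
    using distributed_measurable[OF d] by (subst integral_distr) auto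
  also have "\<dots> = char (density lborel f) t"
    unfolding char_def distributed_distr_eq_density[OF d] ..
  finally show ?thesis by (simp only: char_density_eq_fourier[OF f])
qed

text \<open>Orthogonality of independent centered variables, in complex form; this treats the real and
  imaginary parts of the empirical characteristic function at once.\<close>

lemma (in prob_space) mean_square_sum_centered:
  fixes Y :: "nat \<Rightarrow> 'a \<Rightarrow> real" and g :: "real \<Rightarrow> complex"
  assumes indep: "indep_vars (\<lambda>_. borel) Y I" and I: "finite I"
    and g [measurable]: "g \<in> borel_measurable borel" and bound: "\<And>x. cmod (g x) \<le> C"
    and centered: "\<And>i. i \<in> I \<Longrightarrow> (LINT \<omega>|M. g (Y i \<omega>)) = 0"
    and var: "\<And>i. i \<in> I \<Longrightarrow> (LINT \<omega>|M. (cmod (g (Y i \<omega>)))\<^sup>2) = v"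
  shows "integrable M (\<lambda>\<omega>. (cmod (\<Sum>i\<in>I. g (Y i \<omega>)))\<^sup>2)"
    and "(LINT \<omega>|M. (cmod (\<Sum>i\<in>I. g (Y i \<omega>)))\<^sup>2) = real (card I) * v"
proof -
  have Y [measurable]: "i \<in> I \<Longrightarrow> Y i \<in> borel_measurable M" for i
    using indep by (auto simp: indep_vars_def)
  have gY: "integrable M (\<lambda>\<omega>. g (Y i \<omega>))" if "i \<in> I" for i
    using Y[OF that] bound by (intro integrable_const_bound[of _ C]) auto
  let ?p = "\<lambda>i j \<omega>. g (Y i \<omega>) * cnj (g (Y j \<omega>))"
  have int: "integrable M (?p i j)" if "i \<in> I" "j \<in> I" for i j
  proof (rule integrable_const_bound[of _ "C * C"])
    have "cmod (g x) * cmod (g y) \<le> C * C" for x y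
      using order_trans[OF norm_ge_zero bound] by (intro mult_mono bound) auto
    then show "AE \<omega> in M. cmod (?p i j \<omega>) \<le> C * C" by (simp add: norm_mult)
    show "?p i j \<in> borel_measurable M"
      using Y[OF that(1)] Y[OF that(2)] by measurable
  qed
  have diag: "(LINT \<omega>|M. ?p i i \<omega>) = of_real v" if "i \<in> I" for i
    using var[OF that] by (simp only: complex_norm_square[symmetric] integral_complex_of_real)
  have off: "(LINT \<omega>|M. ?p i j \<omega>) = 0" if "i \<in> I" "j \<in> I" "i \<noteq> j" for i j
  proof -
    define G where "G = (\<lambda>k x. if k = i then g x else cnj (g x))"
    have [measurable]: "G k \<in> borel_measurable borel" for k
      unfolding G_def by measurable
    have "indep_vars (\<lambda>_. borel) (\<lambda>k \<omega>. G k (Y k \<omega>)) {i, j}"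
      by (rule indep_vars_compose2[OF indep_vars_subset[OF indep]]) (use that in auto)
    moreover have "integrable M (\<lambda>\<omega>. G k (Y k \<omega>))" if "k \<in> {i, j}" for k
      using gY[of k] that \<open>i \<in> I\<close> \<open>j \<in> I\<close> by (cases "k = i") (auto simp: G_def)
    ultimately have "(LINT \<omega>|M. (\<Prod>k\<in>{i, j}. G k (Y k \<omega>))) = (\<Prod>k\<in>{i, j}. LINT \<omega>|M. G k (Y k \<omega>))"
      by (intro indep_vars_lebesgue_integral) auto
    then show ?thesis
      using that centered by (simp add: G_def)
  qed
  have eq: "complex_of_real ((cmod (\<Sum>i\<in>I. g (Y i \<omega>)))\<^sup>2) = (\<Sum>i\<in>I. \<Sum>j\<in>I. ?p i j \<omega>)" for \<omega>
    by (simp only: complex_norm_square cnj_sum sum_product)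
  have "integrable M (\<lambda>\<omega>. complex_of_real ((cmod (\<Sum>i\<in>I. g (Y i \<omega>)))\<^sup>2))"
    unfolding eq using int by (intro Bochner_Integration.integrable_sum)
  then show "integrable M (\<lambda>\<omega>. (cmod (\<Sum>i\<in>I. g (Y i \<omega>)))\<^sup>2)"
    by (simp only: complex_of_real_integrable_eq)
  have "complex_of_real (LINT \<omega>|M. (cmod (\<Sum>i\<in>I. g (Y i \<omega>)))\<^sup>2) = (LINT \<omega>|M. (\<Sum>i\<in>I. \<Sum>j\<in>I. ?p i j \<omega>))"
    by (simp only: integral_complex_of_real[symmetric] eq)
  also have "\<dots> = (\<Sum>i\<in>I. \<Sum>j\<in>I. LINT \<omega>|M. ?p i j \<omega>)"
    using int by (simp add: Bochner_Integration.integral_sum Bochner_Integration.integrable_sum)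
  also have "\<dots> = (\<Sum>i\<in>I. \<Sum>j\<in>I. if j = i then of_real v else 0)"
    using diag off by (intro sum.cong) auto
  also have "\<dots> = of_real (real (card I) * v)"
    using I by simp
  finally show "(LINT \<omega>|M. (cmod (\<Sum>i\<in>I. g (Y i \<omega>)))\<^sup>2) = real (card I) * v"
    by (simp only: of_real_eq_iff)
qed

text \<open>The mean of \<open>n\<close> independent variables of modulus 1 and expectation \<open>\<phi>(t)\<close>, each of variance
  \<open>1 - \<bar>\<phi>(t)\<bar>\<^sup>2\<close>.\<close>

lemma empirical_char_mean_square_error:
  assumes iid: "iid_sample M f n X" and f: "prob_density f" and n: "1 \<le> n"
  defines "\<phi> \<equiv> fourier (\<lambda>x. of_real (f x))"
  shows "(\<integral>\<^sup>+ \<omega>. ennreal ((cmod (\<phi> t - empirical_char n (\<lambda>j. X j \<omega>) t))\<^sup>2) \<partial>M)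
    = ennreal ((1 - (cmod (\<phi> t))\<^sup>2) / real n)"
proof -
  interpret prob_space M using iid by (simp add: iid_sample_def)
  have indep: "indep_vars (\<lambda>_. borel) X {1..n}"
    using iid by (simp add: iid_sample_def)
  have X [measurable]: "j \<in> {1..n} \<Longrightarrow> X j \<in> borel_measurable M" for j
    using indep by (auto simp: indep_vars_def)
  define g where "g = (\<lambda>x. iexp (t * x) - \<phi> t)"
  have g_meas: "g \<in> borel_measurable borel"
    unfolding g_def by (intro borel_measurable_continuous_onI continuous_intros)
  have g_bound: "cmod (g x) \<le> 1 + cmod (\<phi> t)" for x
    unfolding g_def using norm_triangle_ineq4[of "iexp (t * x)" "\<phi> t"] by simp
  have e: "integrable M (\<lambda>\<omega>. iexp (t * X j \<omega>))" "(LINT \<omega>|M. iexp (t * X j \<omega>)) = \<phi> t" if "j \<in> {1..n}" for j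
  proof -
    show "integrable M (\<lambda>\<omega>. iexp (t * X j \<omega>))"
      using X[OF that] by (intro integrable_const_bound[of _ 1]) auto
    show "(LINT \<omega>|M. iexp (t * X j \<omega>)) = \<phi> t"
      unfolding \<phi>_def by (rule iid_sample_integral_iexp[OF iid f that])
  qed
  have centered: "(LINT \<omega>|M. g (X j \<omega>)) = 0" if "j \<in> {1..n}" for j
    using e[OF that] by (simp add: g_def prob_space)
  have var: "(LINT \<omega>|M. (cmod (g (X j \<omega>)))\<^sup>2) = 1 - (cmod (\<phi> t))\<^sup>2" if "j \<in> {1..n}" for j
  proof -
    have "(cmod (g x))\<^sup>2 = 1 + (cmod (\<phi> t))\<^sup>2 - 2 * Re (cnj (\<phi> t) * iexp (t * x))" for x
    proof -
      have "(cmod (iexp (t * x)))\<^sup>2 = 1" by simp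
      then show ?thesis
        unfolding g_def cmod_power2 by (simp add: power2_eq_square algebra_simps)
    qed
    then have "(LINT \<omega>|M. (cmod (g (X j \<omega>)))\<^sup>2)
        = (LINT \<omega>|M. 1 + (cmod (\<phi> t))\<^sup>2 - 2 * Re (cnj (\<phi> t) * iexp (t * X j \<omega>)))"
      by simp
    also have "\<dots> = 1 + (cmod (\<phi> t))\<^sup>2 - 2 * (LINT \<omega>|M. Re (cnj (\<phi> t) * iexp (t * X j \<omega>)))"
    proof -
      have "integrable M (\<lambda>\<omega>. Re (cnj (\<phi> t) * iexp (t * X j \<omega>)))"
        by (intro integrable_Re integrable_mult_right e(1)[OF that])
      from Bochner_Integration.integral_diff[OF integrable_const integrable_mult_right[OF this, of 2]]
      show ?thesis by (simp only: integral_mult_right_zero lebesgue_integral_const prob_space scaleR_one)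
    qed
    also have "(LINT \<omega>|M. Re (cnj (\<phi> t) * iexp (t * X j \<omega>))) = Re (cnj (\<phi> t) * \<phi> t)"
      by (subst integral_Re[OF integrable_mult_right[OF e(1)[OF that]]])
        (simp only: integral_mult_right_zero e(2)[OF that])
    also have "Re (cnj (\<phi> t) * \<phi> t) = (cmod (\<phi> t))\<^sup>2"
      unfolding cmod_power2 by (simp add: power2_eq_square)
    finally show ?thesis by simp
  qed
  have eq: "(cmod (\<phi> t - empirical_char n (\<lambda>j. X j \<omega>) t))\<^sup>2 = (cmod (\<Sum>j\<in>{1..n}. g (X j \<omega>)))\<^sup>2 / (real n)\<^sup>2" for \<omega>
  proof -
    have "empirical_char n (\<lambda>j. X j \<omega>) t - \<phi> t = (\<Sum>j\<in>{1..n}. g (X j \<omega>)) / of_nat n"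
      using n by (simp add: empirical_char_def g_def sum_subtractf field_simps)
    then show ?thesis
      by (subst norm_minus_commute) (simp add: norm_divide power_divide)
  qed
  note ms = mean_square_sum_centered[OF indep _ g_meas g_bound centered var]
  have "(\<integral>\<^sup>+ \<omega>. ennreal ((cmod (\<phi> t - empirical_char n (\<lambda>j. X j \<omega>) t))\<^sup>2) \<partial>M)
      = ennreal (LINT \<omega>|M. (cmod (\<Sum>j\<in>{1..n}. g (X j \<omega>)))\<^sup>2 / (real n)\<^sup>2)"
    unfolding eq using ms(1) by (intro nn_integral_eq_integral) auto
  also have "(LINT \<omega>|M. (cmod (\<Sum>j\<in>{1..n}. g (X j \<omega>)))\<^sup>2 / (real n)\<^sup>2) = (1 - (cmod (\<phi> t))\<^sup>2) / real n"
    using ms(2) n by (simp add: power2_eq_square)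
  finally show ?thesis .
qed

section \<open>The mean integrated squared error\<close>

text \<open>For every outcome the integrated squared error is bounded by the weighted distance of \<open>\<phi>\<close> to the
  truncated empirical characteristic function; Tonelli's theorem then moves the expectation inside. Below the
  cutoff it is the variance of the empirical characteristic function, above it \<open>\<bar>\<phi>(t)\<bar>\<^sup>2\<close>.\<close>

lemma MISE_le_fourier:
  assumes f: "prob_density f" "times_differentiable r f"
    and iid: "iid_sample M f n X" and n: "1 \<le> n" and h: "0 < h"
  defines "\<phi> \<equiv> fourier (\<lambda>x. of_real (f x))"
  shows "MISE M X f r n h \<le> ennreal (1 / (2 * pi)) *
     (\<integral>\<^sup>+ t. ennreal (indicator {- (1 / h)..1 / h} t * (t ^ (2 * r) * ((1 - (cmod (\<phi> t))\<^sup>2) / real n))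
         + indicator (- {- (1 / h)..1 / h}) t * (t ^ (2 * r) * (cmod (\<phi> t))\<^sup>2)) \<partial>lborel)"
proof -
  interpret M: prob_space M using iid by (simp add: iid_sample_def)
  interpret P: pair_sigma_finite M lborel ..
  let ?I = "{- (1 / h)..1 / h}"
  have fi: "integrable lborel f" by (rule prob_density_integrable[OF f(1)])
  have [measurable]: "f \<in> borel_measurable borel" using fi by auto
  have [measurable]: "\<phi> \<in> borel_measurable borel" unfolding \<phi>_def by measurable
  have X: "j \<in> {1..n} \<Longrightarrow> X j \<in> borel_measurable M" for j
    using iid by (auto simp: iid_sample_def M.indep_vars_def)
  define \<beta> where "\<beta> = (\<lambda>\<omega> t. indicator ?I t *\<^sub>R empirical_char n (\<lambda>j. X j \<omega>) t)"
  define e where "e = (\<lambda>\<omega> t. t ^ (2 * r) * (cmod (\<phi> t - \<beta> \<omega> t))\<^sup>2)"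
  have em: "(\<lambda>p. empirical_char n (\<lambda>j. X j (fst p)) (snd p)) \<in> borel_measurable (M \<Otimes>\<^sub>M lborel)"
    unfolding empirical_char_def
  proof (intro borel_measurable_divide borel_measurable_sum borel_measurable_const)
    fix j assume "j \<in> {1..n}"
    note [measurable] = X[OF this]
    show "(\<lambda>p. iexp (snd p * X j (fst p))) \<in> borel_measurable (M \<Otimes>\<^sub>M lborel)"
      by (intro measurable_compose[OF _ iexp_measurable]) measurable
  qed
  then have em2 [measurable]: "case_prod e \<in> borel_measurable (M \<Otimes>\<^sub>M lborel)"
    unfolding e_def \<beta>_def split_beta' by measurable
  have "MISE M X f r n h \<le> (\<integral>\<^sup>+ \<omega>. ennreal (1 / (2 * pi)) * (\<integral>\<^sup>+ t. ennreal (e \<omega> t) \<partial>lborel) \<partial>M)"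
    unfolding MISE_def sinc_deriv_estimator_def e_def \<beta>_def \<phi>_def
    by (intro nn_integral_mono nn_integral_square_deriv_diff_le fi f(2)
        times_differentiable_sinc_estimator fourier_truncated_empirical_char h)
  also have "\<dots> = ennreal (1 / (2 * pi)) * (\<integral>\<^sup>+ \<omega>. \<integral>\<^sup>+ t. ennreal (e \<omega> t) \<partial>lborel \<partial>M)"
    by (rule nn_integral_cmult) measurable
  also have "(\<integral>\<^sup>+ \<omega>. \<integral>\<^sup>+ t. ennreal (e \<omega> t) \<partial>lborel \<partial>M) = (\<integral>\<^sup>+ t. \<integral>\<^sup>+ \<omega>. ennreal (e \<omega> t) \<partial>M \<partial>lborel)"
    by (rule P.Fubini'[symmetric]) measurable
  also have "\<dots> = (\<integral>\<^sup>+ t. ennreal (indicator ?I t * (t ^ (2 * r) * ((1 - (cmod (\<phi> t))\<^sup>2) / real n))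
         + indicator (- ?I) t * (t ^ (2 * r) * (cmod (\<phi> t))\<^sup>2)) \<partial>lborel)"
  proof (rule nn_integral_cong)
    fix t :: real
    have t: "0 \<le> t ^ (2 * r)" by simp
    show "(\<integral>\<^sup>+ \<omega>. ennreal (e \<omega> t) \<partial>M) = ennreal (indicator ?I t * (t ^ (2 * r) * ((1 - (cmod (\<phi> t))\<^sup>2) / real n))
         + indicator (- ?I) t * (t ^ (2 * r) * (cmod (\<phi> t))\<^sup>2))"
    proof (cases "t \<in> ?I")
      case True
      have m: "(\<lambda>\<omega>. empirical_char n (\<lambda>j. X j \<omega>) t) \<in> borel_measurable M"
        using measurable_compose[OF measurable_Pair2'[of t lborel M] em] by simp
      have "(\<integral>\<^sup>+ \<omega>. ennreal (e \<omega> t) \<partial>M)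
        = (\<integral>\<^sup>+ \<omega>. ennreal (t ^ (2 * r)) * ennreal ((cmod (\<phi> t - empirical_char n (\<lambda>j. X j \<omega>) t))\<^sup>2) \<partial>M)"
        using True t by (simp add: e_def \<beta>_def ennreal_mult')
      also have "\<dots> = ennreal (t ^ (2 * r)) * ennreal ((1 - (cmod (\<phi> t))\<^sup>2) / real n)"
        using m by (subst nn_integral_cmult)
          (auto simp: empirical_char_mean_square_error[OF iid f(1) n] \<phi>_def)
      also have "\<dots> = ennreal (t ^ (2 * r) * ((1 - (cmod (\<phi> t))\<^sup>2) / real n))"
        by (rule ennreal_mult'[OF t, symmetric])
      finally show ?thesis
        using True by simp
    next
      case False
      then show ?thesis by (simp add: e_def \<beta>_def M.emeasure_space_1)
    qed
  qed
  finally show ?thesis .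
qed

theorem theorem9p1:
  fixes f :: "real \<Rightarrow> real" and r m :: nat
  assumes "prob_density f"
    and "times_differentiable (r + m) f"
    and "square_integrable ((deriv ^^ (r + m)) f)"
  shows "\<exists>\<epsilon> :: real \<Rightarrow> real.
           (\<forall>h>0. \<epsilon> h \<le> 1) \<and> (\<epsilon> \<longlongrightarrow> 0) (at_right 0) \<and>
           (\<forall>(n::nat) (h::real) (M :: 'a measure) (X :: nat \<Rightarrow> 'a \<Rightarrow> real).
              n \<ge> 1 \<longrightarrow> h > 0 \<longrightarrow> iid_sample M f n X \<longrightarrow>
              MISE M X f r n h
                < ennreal (\<epsilon> h * h ^ (2 * m) * R ((deriv ^^ (r + m)) f)
                           + 1 / (pi * (2 * real r + 1) * real n * h ^ (2 * r + 1))))"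
proof -
  note f = assms(1)
  have fi: "integrable lborel f" by (rule prob_density_integrable[OF f])
  have [measurable]: "f \<in> borel_measurable borel" using fi by auto
  define \<phi> where "\<phi> = fourier (\<lambda>x. of_real (f x))"
  have [measurable]: "\<phi> \<in> borel_measurable borel" unfolding \<phi>_def by measurable
  interpret D: real_distribution "density lborel f" by (rule real_distribution_density[OF f])
  have char: "char (density lborel f) = \<phi>"
    unfolding \<phi>_def by (rule ext) (rule char_density_eq_fourier[OF f])
  have \<phi>0: "\<phi> 0 = 1" and \<phi>1: "cmod (\<phi> t) \<le> 1" and \<phi>c: "isCont \<phi> t" for t
    using D.char_zero D.cmod_char_le_1[of t] D.isCont_char[of t] unfolding char by auto
  have \<phi>2: "(cmod (\<phi> t))\<^sup>2 \<le> 1" for t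
    using \<phi>1 by (simp add: power_le_one)

  define \<rho> where "\<rho> = R ((deriv ^^ (r + m)) f)"
  have sq: "integrable lborel (\<lambda>x. ((deriv ^^ (r + m)) f x)\<^sup>2)"
    using assms(3) by (simp add: square_integrable_def)
  have \<rho>: "(\<integral>\<^sup>+ x. ennreal (((deriv ^^ (r + m)) f x)\<^sup>2) \<partial>lborel) = ennreal \<rho>" "0 \<le> \<rho>"
    using nn_integral_eq_integral[OF sq] by (auto simp: \<rho>_def R_def)

  define p where "p = (\<lambda>t. t ^ (2 * (r + m)) * (cmod (\<phi> t))\<^sup>2)"
  have p_meas [measurable]: "p \<in> borel_measurable borel" unfolding p_def by measurable
  have p0: "0 \<le> p t" for t
    unfolding p_def by (intro mult_nonneg_nonneg zero_le_even_power) auto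
  have p_le: "(\<integral>\<^sup>+ t. ennreal (p t) \<partial>lborel) \<le> ennreal (2 * pi * \<rho>)"
    using nn_integral_fourier_moment_le[OF fi assms(2,3)] \<rho>
    by (simp add: p_def \<phi>_def ennreal_mult)
  have p_int: "integrable lborel p"
    using p_le p0 by (intro integrableI_nonneg) (auto intro: le_less_trans)
  have p_LBINT: "(LBINT t. p t) \<le> 2 * pi * \<rho>"
    using p_le \<rho>(2) nn_integral_eq_integral[OF p_int] p0 by simp

  define S where "S = (\<lambda>T. LBINT t. indicator (- {- T..T}) t * p t)"
  have pT_int: "integrable lborel (\<lambda>t. indicator (- {- T..T}) t * p t)" for T :: real
    using integrable_mult_indicator[OF _ p_int, of "- {- T..T}"] by simp
  have S_le: "S T \<le> 2 * pi * \<rho>" and S0: "0 \<le> S T" for T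
  proof -
    have "S T \<le> (LBINT t. p t)"
      unfolding S_def by (intro integral_mono pT_int p_int) (simp add: p0 split: split_indicator)
    then show "S T \<le> 2 * pi * \<rho>" using p_LBINT by simp
    show "0 \<le> S T" unfolding S_def by (intro Bochner_Integration.integral_nonneg) (simp add: p0)
  qed
  have S_lim: "(S \<longlongrightarrow> 0) at_top"
  proof -
    have "(S \<longlongrightarrow> (LBINT t::real. 0 :: real)) at_top"
      unfolding S_def
    proof (rule integral_dominated_convergence_at_top[where w = p])
      show "AE t in lborel. ((\<lambda>T. indicator (- {- T..T}) t * p t) \<longlongrightarrow> 0) at_top"
      proof (rule AE_I2)
        fix t :: real
        have "\<forall>\<^sub>F T in at_top. indicator (- {- T..T}) t * p t = 0"
          using eventually_ge_at_top[of "\<bar>t\<bar>"] by eventually_elim (auto split: split_indicator)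
        then show "((\<lambda>T. indicator (- {- T..T}) t * p t) \<longlongrightarrow> 0) at_top"
          by (rule tendsto_eventually)
      qed
      show "\<forall>\<^sub>F T in at_top. AE t in lborel. norm (indicator (- {- T..T}) t * p t) \<le> p t"
        by (intro always_eventually allI AE_I2) (simp add: p0 split: split_indicator)
    qed (use p_int in auto)
    then show ?thesis by simp
  qed

  define \<epsilon> where "\<epsilon> = (\<lambda>h. S (1 / h) / (2 * pi * \<rho>))"
  have \<epsilon>_le: "\<epsilon> h \<le> 1" for h
    using S_le[of "1 / h"] \<rho>(2) unfolding \<epsilon>_def
    by (cases "\<rho> = 0") (auto simp: divide_le_eq_1 mult_less_0_iff)
  have \<epsilon>_lim: "(\<epsilon> \<longlongrightarrow> 0) (at_right 0)"
  proof -
    have "((\<lambda>T. S T * (1 / (2 * pi * \<rho>))) \<longlongrightarrow> 0 * (1 / (2 * pi * \<rho>))) at_top"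
      by (intro tendsto_mult S_lim tendsto_const)
    then show ?thesis
      unfolding filterlim_at_right_to_top by (simp add: \<epsilon>_def inverse_eq_divide)
  qed
  \<comment> \<open>also true if \<open>\<rho> = 0\<close>, where \<open>\<epsilon>\<close> is 0 by the convention on division, since then \<open>S\<close> vanishes\<close>
  have \<epsilon>_eq: "\<epsilon> h * \<rho> = S (1 / h) / (2 * pi)" for h
    using S_le[of "1 / h"] S0[of "1 / h"] by (cases "\<rho> = 0") (auto simp: \<epsilon>_def)

  have bound: "MISE M X f r n h < ennreal (\<epsilon> h * h ^ (2 * m) * \<rho>
        + 1 / (pi * (2 * real r + 1) * real n * h ^ (2 * r + 1)))"
    if n: "1 \<le> n" and h: "0 < h" and iid: "iid_sample M f n X"
    for n :: nat and h :: real and M :: "'a measure" and X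
  proof -
    define T where "T = 1 / h"
    have T: "0 < T" using h by (simp add: T_def)
    define a where "a = (\<lambda>t. t ^ (2 * r) * (cmod (\<phi> t))\<^sup>2)"
    have a0: "0 \<le> a t" for t by (simp add: a_def)
    have [measurable]: "a \<in> borel_measurable borel" unfolding a_def by measurable
    have pow_int: "integrable lborel (\<lambda>t. indicator {b..c} t * t ^ (2 * r))" for b c :: real
    proof -
      have "continuous_on {b..c} (\<lambda>t::real. t ^ (2 * r))" by (intro continuous_intros)
      from borel_integrable_compact[OF _ this] show ?thesis by simp
    qed
    have pow_eq: "(LBINT t. indicator {b..c} t * t ^ (2 * r)) = (c ^ (2 * r + 1) - b ^ (2 * r + 1)) / (2 * real r + 1)"
      if "b \<le> c" for b c :: real
      using integral_power[OF that, of "2 * r"] by (simp add: mult.commute add.commute)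
    have in_int: "integrable lborel (\<lambda>t. indicator {- T..T} t * a t)"
      by (rule Bochner_Integration.integrable_bound[OF pow_int])
        (auto simp: a_def \<phi>2 abs_mult power_mult split: split_indicator intro!: mult_left_le)
    define J where "J = (LBINT t. indicator {- T..T} t * a t)"
    \<comment> \<open>the source of the strict inequality\<close>
    have J: "0 < J"
    proof -
      obtain \<delta> where \<delta>: "0 < \<delta>" "\<And>t. \<bar>t\<bar> < \<delta> \<Longrightarrow> cmod (\<phi> t - 1) < 1 / 2"
        using \<phi>c[of 0, unfolded continuous_at_eps_delta, rule_format, of "1 / 2"] \<phi>0
        by (auto simp: dist_norm)
      define c where "c = min T (\<delta> / 2)"
      have c: "0 < c" "c \<le> T" "c < \<delta>" using T \<delta>(1) by (auto simp: c_def)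
      \<comment> \<open>\<open>\<bar>\<phi>\<bar> \<ge> 1/2\<close> on \<open>[0, c]\<close>\<close>
      have "0 < 1 / 4 * (LBINT t. indicator {0..c} t * t ^ (2 * r))"
        using c by (subst pow_eq) auto
      also have "\<dots> = (LBINT t. 1 / 4 * (indicator {0..c} t * t ^ (2 * r)))"
        by (rule integral_mult_right_zero[symmetric])
      also have "\<dots> \<le> J"
        unfolding J_def
      proof (rule integral_mono)
        show "integrable lborel (\<lambda>t. 1 / 4 * (indicator {0..c} t * t ^ (2 * r)))"
          by (intro integrable_mult_right pow_int)
        fix t
        show "1 / 4 * (indicator {0..c} t * t ^ (2 * r)) \<le> indicator {- T..T} t * a t"
        proof (cases "t \<in> {0..c}")
          case True
          then have "cmod (\<phi> t - 1) < 1 / 2" using c \<delta>(2)[of t] by auto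
          moreover have "1 \<le> cmod (\<phi> t) + cmod (\<phi> t - 1)"
            using norm_triangle_ineq4[of "\<phi> t" "\<phi> t - 1"] by simp
          ultimately have "(1 / 2)\<^sup>2 \<le> (cmod (\<phi> t))\<^sup>2" by (intro power_mono) auto
          then have "t ^ (2 * r) * (1 / 4) \<le> t ^ (2 * r) * (cmod (\<phi> t))\<^sup>2"
            by (intro mult_left_mono) (auto simp: power2_eq_square)
          then show ?thesis using True c by (simp add: a_def)
        next
          case False
          then show ?thesis using a0 by simp
        qed
      qed (rule in_int)
      finally show ?thesis .
    qed
    have tail_le: "indicator (- {- T..T}) t * a t \<le> h ^ (2 * m) * (indicator (- {- T..T}) t * p t)" for t
    proof (cases "t \<in> {- T..T}")
      case False
      then have "1 \<le> \<bar>h * t\<bar>"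
        using h by (auto simp: T_def abs_mult field_simps abs_if)
      then have "1 \<le> \<bar>h * t\<bar> ^ (2 * m)" by simp
      then have "1 \<le> (h * t) ^ (2 * m)" by (simp add: power_even_abs)
      then have "a t * 1 \<le> a t * (h * t) ^ (2 * m)" by (intro mult_left_mono a0)
      also have "\<dots> = h ^ (2 * m) * p t"
        by (simp add: a_def p_def power_mult_distrib power_add algebra_simps)
      finally show ?thesis using False by simp
    qed simp
    have out_int: "integrable lborel (\<lambda>t. indicator (- {- T..T}) t * a t)"
      by (rule Bochner_Integration.integrable_bound[OF integrable_mult_right[OF pT_int[of T], of "h ^ (2 * m)"]])
        (use tail_le a0 p0 h in \<open>auto simp: abs_mult split: split_indicator_asm\<close>)
    define w where "w = (\<lambda>t. indicator {- T..T} t * (t ^ (2 * r) * ((1 - (cmod (\<phi> t))\<^sup>2) / real n)))"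
    have w_eq: "w t = (indicator {- T..T} t * t ^ (2 * r) - indicator {- T..T} t * a t) / real n" for t
      by (simp add: w_def a_def algebra_simps diff_divide_distrib)
    have w_int: "integrable lborel w"
      unfolding w_eq[abs_def] using pow_int in_int by auto
    have w0: "0 \<le> w t" for t
      unfolding w_def using \<phi>2 by simp
    have w_LBINT: "(LBINT t. w t) = (2 * T ^ (2 * r + 1) / (2 * real r + 1) - J) / real n"
      unfolding w_eq J_def using pow_int in_int pow_eq[of "- T" T] T by simp
    have out_LBINT: "(LBINT t. indicator (- {- T..T}) t * a t) \<le> h ^ (2 * m) * S T"
      unfolding S_def integral_mult_right_zero[symmetric]
      by (intro integral_mono out_int integrable_mult_right pT_int tail_le)
    have half_pi_inv: "0 \<le> 1 / (2 * pi)" by simp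
    have "MISE M X f r n h \<le> ennreal (1 / (2 * pi)) *
        (\<integral>\<^sup>+ t. ennreal (w t + indicator (- {- T..T}) t * a t) \<partial>lborel)"
      using MISE_le_fourier[OF f times_differentiable_mono[OF assms(2)] iid n h]
      by (simp add: w_def a_def T_def \<phi>_def)
    also have "(\<integral>\<^sup>+ t. ennreal (w t + indicator (- {- T..T}) t * a t) \<partial>lborel)
        = ennreal (LBINT t. w t + indicator (- {- T..T}) t * a t)"
      by (intro nn_integral_eq_integral Bochner_Integration.integrable_add w_int out_int AE_I2 add_nonneg_nonneg w0)
        (simp add: a0)
    also have "(LBINT t. w t + indicator (- {- T..T}) t * a t)
        = (LBINT t. w t) + (LBINT t. indicator (- {- T..T}) t * a t)"
      by (rule Bochner_Integration.integral_add[OF w_int out_int])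
    finally have "MISE M X f r n h \<le>
        ennreal (1 / (2 * pi) * ((LBINT t. w t) + (LBINT t. indicator (- {- T..T}) t * a t)))"
      by (simp only: ennreal_mult'[of "1 / (2 * pi)", OF half_pi_inv])
    also have "\<dots> < ennreal (\<epsilon> h * h ^ (2 * m) * \<rho> + 1 / (pi * (2 * real r + 1) * real n * h ^ (2 * r + 1)))"
    proof (rule ennreal_lessI)
      have "(LBINT t. w t) < 2 * T ^ (2 * r + 1) / (2 * real r + 1) / real n"
        unfolding w_LBINT using J n by (intro divide_strict_right_mono) auto
      then have "1 / (2 * pi) * ((LBINT t. w t) + (LBINT t. indicator (- {- T..T}) t * a t))
        < 1 / (2 * pi) * (2 * T ^ (2 * r + 1) / (2 * real r + 1) / real n + h ^ (2 * m) * S T)"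
        using out_LBINT by (intro mult_strict_left_mono) auto
      also have "1 / (2 * pi) * (2 * A / B / N + C * E) = C * (E / (2 * pi)) + A / (pi * B * N)" for A B C E N :: real
        by (simp add: distrib_left mult.assoc)
      also have "S T / (2 * pi) = \<epsilon> h * \<rho>" by (simp add: \<epsilon>_eq T_def)
      also have "h ^ (2 * m) * (\<epsilon> h * \<rho>) + T ^ (2 * r + 1) / (pi * (2 * real r + 1) * real n)
        = \<epsilon> h * h ^ (2 * m) * \<rho> + 1 / (pi * (2 * real r + 1) * real n * h ^ (2 * r + 1))"
        by (simp add: T_def power_divide mult_ac)
      finally show lt: "1 / (2 * pi) * ((LBINT t. w t) + (LBINT t. indicator (- {- T..T}) t * a t))
        < \<epsilon> h * h ^ (2 * m) * \<rho> + 1 / (pi * (2 * real r + 1) * real n * h ^ (2 * r + 1))" .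
      have "0 \<le> 1 / (2 * pi) * ((LBINT t. w t) + (LBINT t. indicator (- {- T..T}) t * a t))"
        by (intro mult_nonneg_nonneg add_nonneg_nonneg Bochner_Integration.integral_nonneg) (simp_all add: w0 a0)
      then show "0 < \<epsilon> h * h ^ (2 * m) * \<rho> + 1 / (pi * (2 * real r + 1) * real n * h ^ (2 * r + 1))"
        using lt by linarith
    qed
    finally show ?thesis .
  qed
  show ?thesis
    using \<epsilon>_le \<epsilon>_lim bound unfolding \<rho>_def by (intro exI[of _ \<epsilon>]) blast
qed

end
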